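(* Let $n \ge 1$ and let $K \subset \mathbb{R}$ be compact. Suppose $\Gamma = (f_1,g_1,\dots,f_n,g_n,h) : K \to \mathbb{H}^n$ and $\Gamma' = (f_1',g_1',\dots,f_n',g_n',h') : K \to \mathbb{H}^n$ are continuous. Then there is a horizontal $C^1$ curve $\tilde{\Gamma} : \mathbb{R} \to \mathbb{H}^n$ such that $\tilde{\Gamma}|_K = \Gamma$ and $\tilde{\Gamma}'|_K = \Gamma'$ if and only if both $$\lim_{\substack{b-a \to 0^+ \\ a,b \in K}} \left| \delta_{(b-a)^{-1}} \left( \Gamma(a)^{-1} * \Gamma(b) \right) - \Gamma_0'(a) \right| =0,$$ where $\Gamma_0' = (f_1',g_1',\dots,f_n',g_n',0)$, and $$h'(s)=2 \sum_{j=1}^n \left(f_j'(s)g_j(s)-g_j'(s)f_j(s) \right) \quad \text{for every } s \in K.$$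
   Context: The Heisenberg group $\mathbb{H}^n$ is $\mathbb{R}^{2n+1}$ with the Lie group multiplication $$(x_1,y_1,\dots,x_n,y_n,t)*(x_1',y_1',\dots,x_n',y_n',t') = \Big(x_1+x_1', y_1+y_1',\dots,x_n+x_n',y_n+y_n',\, t+t'+2\sum_{j=1}^n (x_j'y_j - x_jy_j')\Big),$$ with identity $0$ and inverse $p^{-1}=-p$. Dilations are $\delta_r(x_1,y_1,\dots,x_n,y_n,t) = (rx_1,ry_1,\dots,rx_n,ry_n,r^2t)$ for $r>0$. The norm $|\cdot|$ and the difference in the limit are the Euclidean ones of $\mathbb{R}^{2n+1}$. The horizontal distribution is the span of $X_j = \partial_{x_j} + 2y_j\partial_t$, $Y_j = \partial_{y_j} - 2x_j\partial_t$, $j=1,\dots,n$. A $C^1$ curve $\tilde\Gamma=(\tilde f_1,\tilde g_1,\dots,\tilde f_n,\tilde g_n,\tilde h):\mathbb{R}\to\mathbb{R}^{2n+1}$ ($C^1$ in the usual Euclidean sense) is horizontal if $\tilde\Gamma'(s)$ lies in the horizontal space at $\tilde\Gamma(s)$ for every $s$, equivalently $\tilde h' = 2\sum_{j=1}^n(\tilde f_j'\tilde g_j-\tilde f_j\tilde g_j')$ on $\mathbb{R}$. Here $\Gamma'$ and its components $f_j',g_j',h'$ are just given continuous functions on $K$, a priori unrelated to classical derivatives. The limit as $b-a\to0^+$ with $a,b\in K$ is uniform: for every $\varepsilon>0$ there is $\delta>0$ such that the quantity is less than $\varepsilon$ for all $a,b\in K$ with $0<b-a<\delta$. *)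

theory Defs
  imports "HOL-Analysis.Analysis"
begin

text \<open>
  The point \<open>(x\<^sub>1, y\<^sub>1, \<dots>, x\<^sub>n, y\<^sub>n, t)\<close> is encoded as the vector of the pairs
  \<open>(x\<^sub>j, y\<^sub>j)\<close> together with \<open>t\<close>, and \<open>n\<close> is the cardinality of the finite index type.
  The library norm, distance and topology of this type are the Euclidean ones of
  real \<open>(2n+1)\<close>-space; its \<open>+\<close> and \<open>-\<close> are the vector space operations, not the group law.
\<close>
type_synonym 'n heis = "((real \<times> real) ^ 'n) \<times> real"

abbreviation xc :: "'n::finite heis \<Rightarrow> 'n \<Rightarrow> real"
  where "xc p j \<equiv> fst (fst p $ j)"

abbreviation yc :: "'n::finite heis \<Rightarrow> 'n \<Rightarrow> real"
  where "yc p j \<equiv> snd (fst p $ j)"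

abbreviation tc :: "'n::finite heis \<Rightarrow> real"
  where "tc p \<equiv> snd p"

definition heis_mult :: "'n::finite heis \<Rightarrow> 'n heis \<Rightarrow> 'n heis"
  where "heis_mult p q =
    ((\<chi> j. (xc p j + xc q j, yc p j + yc q j)),
     tc p + tc q + 2 * (\<Sum>j\<in>UNIV. xc q j * yc p j - xc p j * yc q j))"

definition heis_inv :: "'n::finite heis \<Rightarrow> 'n heis"
  where "heis_inv p = - p"

definition heis_dil :: "real \<Rightarrow> 'n::finite heis \<Rightarrow> 'n heis"
  where "heis_dil r p = ((\<chi> j. (r * xc p j, r * yc p j)), r\<^sup>2 * tc p)"

lemma heis_mult_assoc: "heis_mult (heis_mult p q) r = heis_mult p (heis_mult q r)"
  by (simp add: heis_mult_def vec_eq_iff algebra_simps sum.distrib sum_subtractf)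

lemma heis_mult_zero: "heis_mult 0 p = p" "heis_mult p 0 = p"
  by (simp_all add: heis_mult_def prod_eq_iff vec_eq_iff)

lemma heis_mult_inv: "heis_mult (heis_inv p) p = 0" "heis_mult p (heis_inv p) = 0"
  by (simp_all add: heis_mult_def heis_inv_def prod_eq_iff vec_eq_iff)

text \<open>
  The vector fields \<open>X\<^sub>j = \<partial>\<^bsub>x\<^sub>j\<^esub> + 2 y\<^sub>j \<partial>\<^sub>t\<close> and \<open>Y\<^sub>j = \<partial>\<^bsub>y\<^sub>j\<^esub> - 2 x\<^sub>j \<partial>\<^sub>t\<close>, with tangent
  spaces identified with the ambient vector space.
\<close>
definition heis_X :: "'n::finite \<Rightarrow> 'n heis \<Rightarrow> 'n heis"
  where "heis_X j p = (axis j (1, 0), 2 * yc p j)"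

definition heis_Y :: "'n::finite \<Rightarrow> 'n heis \<Rightarrow> 'n heis"
  where "heis_Y j p = (axis j (0, 1), - 2 * xc p j)"

definition horizontal_space :: "'n::finite heis \<Rightarrow> 'n heis set"
  where "horizontal_space p = span (range (\<lambda>j. heis_X j p) \<union> range (\<lambda>j. heis_Y j p))"

definition horizontal_C1_curve :: "(real \<Rightarrow> 'n::finite heis) \<Rightarrow> bool"
  where "horizontal_C1_curve \<gamma> \<longleftrightarrow>
    \<gamma> C1_differentiable_on UNIV \<and>
    (\<forall>s. vector_derivative \<gamma> (at s) \<in> horizontal_space (\<gamma> s))"

end

theory Submission
  imports Defs
begin

text \<open>
  Write \<open>\<omega> (p, q) = \<Sum>\<^sub>j (x\<^sub>j(p) y\<^sub>j(q) - y\<^sub>j(p) x\<^sub>j(q))\<close> for the standard symplectic form on the horizontal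
  layer. A curve \<open>(u, h)\<close> is horizontal iff \<open>h' = 2 \<omega> (u', u)\<close>, and the Pansu condition says that
  \<open>u b - u a - (b - a) u' a\<close> is \<open>o(b - a)\<close> and \<open>h b - h a - 2 \<omega> (u b, u a)\<close> is \<open>o((b - a)\<^sup>2)\<close>. For a
  horizontal curve the latter is \<open>2 \<integral> \<omega> (u' t, u t - u a) dt\<close> over \<open>[a, b]\<close>, whose integrand is
  \<open>o(b - a)\<close> because \<open>\<omega> (w, w) = 0\<close>.

  Conversely, extend the horizontal velocity continuously from \<open>K\<close> to the line by Tietze's theorem. On
  each gap of \<open>K\<close> add a parabolic bump, which corrects the displacement, and a multiple of the velocity
  of a fixed closed planar loop, which corrects the area \<open>\<integral> \<omega> (u', u)\<close>. The loop encloses nonzero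
  area and has centre of mass \<open>0\<close>, so its interaction with an almost constant velocity is small, and its
  size solves a quadratic equation with small coefficients. The corrections vanish at the end points
  of the gaps and tend to \<open>0\<close> with the gap length, hence glue to a continuous function. Finally, a
  \<open>C\<^sup>1\<close> function whose derivative and whose increments over the gaps are the prescribed ones agrees
  with the data on \<open>K\<close> up to a constant, first for \<open>u\<close> and then for \<open>h\<close>.
\<close>

section \<open>The symplectic form and horizontality\<close>

definition symp :: "(real \<times> real) ^ 'n::finite \<Rightarrow> (real \<times> real) ^ 'n \<Rightarrow> real"
  where "symp p q = (\<Sum>j\<in>UNIV. fst (p $ j) * snd (q $ j) - snd (p $ j) * fst (q $ j))"

text \<open>The standard complex structure up to sign. It is an isometry that turns
  \<open>symp\<close> into an inner product, so Cauchy-Schwarz bounds \<open>symp\<close> with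
  constant one.\<close>

definition quarter_turn :: "(real \<times> real) ^ 'n::finite \<Rightarrow> (real \<times> real) ^ 'n"
  where "quarter_turn q = (\<chi> j. (snd (q $ j), - fst (q $ j)))"

lemma symp_inner: "symp p q = p \<bullet> quarter_turn q"
  by (simp add: symp_def quarter_turn_def inner_vec_def inner_prod_def)

lemma norm_quarter_turn: "norm (quarter_turn q) = norm q"
  by (simp add: norm_eq_sqrt_inner quarter_turn_def inner_vec_def inner_prod_def add.commute)

lemma abs_symp_le: "\<bar>symp p q\<bar> \<le> norm p * norm q"
  unfolding symp_inner using Cauchy_Schwarz_ineq2[of p "quarter_turn q"]
  by (simp add: norm_quarter_turn)

lemma symp_skew: "symp p q = - symp q p"
  by (simp add: symp_def sum_negf[symmetric] algebra_simps)

lemma symp_self [simp]: "symp p p = 0"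
  by (simp add: symp_def)

lemma bounded_bilinear_symp: "bounded_bilinear symp"
proof (rule bounded_bilinear.intro)
  show "\<exists>K. \<forall>a b. norm (symp a b) \<le> norm a * norm b * K"
    by (rule exI[of _ 1]) (simp add: abs_symp_le)
qed (simp_all add: symp_def algebra_simps sum.distrib sum_subtractf sum_distrib_left)

interpretation symp: bounded_bilinear symp
  by (rule bounded_bilinear_symp)

lemmas symp_linear_simps = symp.add_left symp.add_right symp.diff_left symp.diff_right
  symp.scaleR_left symp.scaleR_right

section \<open>Calculus of curves with almost constant velocity\<close>

lemma symp_has_vector_derivative:
  assumes "(f has_vector_derivative f') (at x within S)"
    and "(g has_vector_derivative g') (at x within S)"
  shows "((\<lambda>t. symp (f t) (g t)) has_vector_derivative symp f' (g x) + symp (f x) g') (at x within S)"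
  using symp.FDERIV[OF assms[unfolded has_vector_derivative_def]]
  unfolding has_vector_derivative_def
  by (rule has_derivative_eq_rhs) (simp add: fun_eq_iff algebra_simps symp_linear_simps)

text \<open>Mean value inequality for \<open>f t - t *\<^sub>R w\<close>. With \<open>w = 0\<close>
  it bounds increments, and with \<open>e = 0\<close> as well it shows that curves with equal
  velocity and start agree.\<close>

lemma vector_derivative_deviation:
  fixes f :: "real \<Rightarrow> 'a::real_normed_vector"
  assumes f: "\<And>t. t \<in> {a..b} \<Longrightarrow> (f has_vector_derivative f' t) (at t within {a..b})"
    and e: "\<And>t. t \<in> {a..b} \<Longrightarrow> norm (f' t - w) \<le> e"
    and t: "t \<in> {a..b}"
  shows "norm (f t - f a - (t - a) *\<^sub>R w) \<le> e * (t - a)"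
proof -
  let ?g = "\<lambda>t. f t - t *\<^sub>R w"
  have "norm (?g t - ?g a) \<le> e * norm (t - a)"
  proof (rule differentiable_bound[where S = "{a..b}" and f' = "\<lambda>x h. h *\<^sub>R (f' x - w)"])
    show "(?g has_derivative (\<lambda>h. h *\<^sub>R (f' x - w))) (at x within {a..b})" if "x \<in> {a..b}" for x
      using f[OF that] unfolding has_vector_derivative_def
      by (auto intro!: derivative_eq_intros simp: algebra_simps)
    show "onorm (\<lambda>h. h *\<^sub>R (f' x - w)) \<le> e" if "x \<in> {a..b}" for x
    proof (rule onorm_le)
      show "norm (h *\<^sub>R (f' x - w)) \<le> e * norm h" for h
        using mult_right_mono[OF e[OF that], of "\<bar>h\<bar>"] by (simp add: mult.commute)
    qed
  qed (use t in auto)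
  with t show ?thesis by (simp add: algebra_simps)
qed

text \<open>Split velocity and increment into a part along \<open>w\<close> and a remainder. The
  term \<open>symp w w\<close> vanishes, so every surviving term carries a factor \<open>e\<close>.
  This is what makes area errors second order.\<close>

lemma symp_velocity_increment_le:
  assumes u: "\<And>t. t \<in> {a..b} \<Longrightarrow> (u has_vector_derivative v t) (at t within {a..b})"
    and e: "\<And>t. t \<in> {a..b} \<Longrightarrow> norm (v t - w) \<le> e"
    and M: "norm w \<le> M"
    and t: "t \<in> {a..b}"
  shows "\<bar>symp (v t) (u t - u a)\<bar> \<le> (2 * M * e + e\<^sup>2) * (b - a)"
proof -
  define x where "x = v t - w"
  define y where "y = u t - u a - (t - a) *\<^sub>R w"
  have x: "norm x \<le> e" using e[OF t] by (simp add: x_def)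
  have e0: "0 \<le> e" using x norm_ge_zero order_trans by blast
  have M0: "0 \<le> M" using M norm_ge_zero order_trans by blast
  have y: "norm y \<le> e * (t - a)"
    unfolding y_def by (rule vector_derivative_deviation[OF u e t])
  have ta: "0 \<le> t - a" "t - a \<le> b - a" using t by auto
  have "symp (v t) (u t - u a) = symp (w + x) ((t - a) *\<^sub>R w + y)"
    by (simp add: x_def y_def)
  also have "\<dots> = symp w y + (t - a) * symp x w + symp x y"
    by (simp add: symp_linear_simps algebra_simps)
  finally have eq: "symp (v t) (u t - u a) = symp w y + (t - a) * symp x w + symp x y" .
  have 1: "\<bar>symp w y\<bar> \<le> M * (e * (t - a))"
    by (rule order_trans[OF abs_symp_le mult_mono]) (use M y M0 in auto)
  have "\<bar>symp x w\<bar> \<le> e * M"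
    by (rule order_trans[OF abs_symp_le mult_mono]) (use M x e0 in auto)
  hence 2: "\<bar>(t - a) * symp x w\<bar> \<le> (t - a) * (e * M)"
    using ta by (simp add: abs_mult mult_left_mono)
  have 3: "\<bar>symp x y\<bar> \<le> e * (e * (t - a))"
    by (rule order_trans[OF abs_symp_le mult_mono]) (use x y e0 in auto)
  have "\<bar>symp (v t) (u t - u a)\<bar> \<le> M * (e * (t - a)) + (t - a) * (e * M) + e * (e * (t - a))"
    unfolding eq using 1 2 3 by linarith
  also have "\<dots> = (2 * M * e + e\<^sup>2) * (t - a)" by (simp add: algebra_simps power2_eq_square)
  also have "\<dots> \<le> (2 * M * e + e\<^sup>2) * (b - a)"
    using ta M0 e0 by (intro mult_left_mono) auto
  finally show ?thesis .
qed

lemma antiderivative_exists: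
  fixes v :: "real \<Rightarrow> 'a::euclidean_space"
  assumes "continuous_on UNIV v"
  shows "\<exists>V. \<forall>t. (V has_vector_derivative v t) (at t)"
  using einterval_antiderivative[of "-\<infinity>" \<infinity> v] assms
  by (auto simp: continuous_on_eq_continuous_at)

lemma uniform_linearization:
  fixes v :: "real \<Rightarrow> 'a::real_normed_vector"
  assumes K: "compact K"
    and v: "continuous_on UNIV v"
    and "0 < e"
  obtains d where "0 < d" "\<And>a t. a \<in> K \<Longrightarrow> \<bar>t - a\<bar> < d \<Longrightarrow> norm (v t - v a) \<le> e"
proof -
  obtain B where B: "\<And>x. x \<in> K \<Longrightarrow> \<bar>x\<bar> \<le> B"
    using compact_imp_bounded[OF K] unfolding bounded_iff by auto
  \<comment> \<open>The margin of one leaves room for \<open>t\<close> outside \<open>K\<close>;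
    hence the cap at one on the radius.\<close>
  have "uniformly_continuous_on {- B - 1..B + 1} v"
    by (rule compact_uniformly_continuous[OF continuous_on_subset[OF v]]) auto
  then obtain d where d: "0 < d" "\<And>x y. x \<in> {- B - 1..B + 1} \<Longrightarrow> y \<in> {- B - 1..B + 1}
      \<Longrightarrow> dist y x < d \<Longrightarrow> dist (v y) (v x) < e"
    using \<open>0 < e\<close> unfolding uniformly_continuous_on_def by meson
  show thesis
  proof (rule that[of "min d 1"])
    show "norm (v t - v a) \<le> e" if "a \<in> K" "\<bar>t - a\<bar> < min d 1" for a t
      using d(2)[of a t] B[of a] that by (fastforce simp: dist_norm)
  qed (use d in auto)
qed

section \<open>Group quotient and horizontal space in terms of \<open>symp\<close>\<close>

lemma heis_quotient:
  "heis_dil r (heis_mult (heis_inv p) q)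
    = (r *\<^sub>R (fst q - fst p), r\<^sup>2 * (snd q - snd p - 2 * symp (fst q) (fst p)))"
  by (simp add: heis_dil_def heis_mult_def heis_inv_def symp_def vec_eq_iff prod_eq_iff
      algebra_simps sum_subtractf sum_distrib_left sum_negf)

text \<open>The frame fields span the kernel of the contact form: both solve its linear equation,
  and the horizontal coordinates of a solution are its coefficients in the frame.\<close>

lemma horizontal_space_iff: "v \<in> horizontal_space p \<longleftrightarrow> snd v = 2 * symp (fst v) (fst p)"
proof
  let ?S = "range (\<lambda>j. heis_X j p) \<union> range (\<lambda>j. heis_Y j p)"
  show "snd v = 2 * symp (fst v) (fst p)" if "v \<in> horizontal_space p"
    using that unfolding horizontal_space_def
  proof (induction rule: span_induct)
    case base
    show ?case
      by (auto simp: subspace_def symp_linear_simps algebra_simps symp.zero_left)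
  next
    case (step x)
    thus ?case
      by (auto simp: heis_X_def heis_Y_def symp_def axis_def if_distrib[of fst] if_distrib[of snd]
          if_distrib[of "\<lambda>z. z * _"] if_distrib[of uminus] cong: if_cong)
  qed
  show "v \<in> horizontal_space p" if v: "snd v = 2 * symp (fst v) (fst p)"
  proof -
    have "v = (\<Sum>j\<in>UNIV. fst (fst v $ j) *\<^sub>R heis_X j p + snd (fst v $ j) *\<^sub>R heis_Y j p)"
      (is "v = ?r")
    proof (rule prod_eqI)
      show "fst v = fst ?r"
        by (auto simp: fst_sum heis_X_def heis_Y_def vec_eq_iff axis_def prod_eq_iff snd_sum
            if_distrib[of fst] if_distrib[of snd] if_distrib[of "(*\<^sub>R) _"] if_distrib[of "(*) _"]
            cong: if_cong)
      show "snd v = snd ?r"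
        by (simp add: v snd_sum heis_X_def heis_Y_def symp_def sum_distrib_left algebra_simps)
    qed
    also have "\<dots> \<in> span ?S"
      by (intro span_sum span_add span_scale span_base) auto
    finally show ?thesis unfolding horizontal_space_def .
  qed
qed

section \<open>Gaps of a closed set of reals\<close>

definition gap :: "real set \<Rightarrow> real \<Rightarrow> real \<Rightarrow> bool"
  where "gap K a b \<longleftrightarrow> a \<in> K \<and> b \<in> K \<and> a < b \<and> K \<inter> {a<..<b} = {}"

text \<open>End points of one gap belong to \<open>K\<close> and so cannot lie inside the other.
  This makes the selection of a gap in the gluing unambiguous.\<close>

lemma gap_unique:
  assumes "gap K a b" "gap K a' b'" "t \<in> {a<..<b}" "t \<in> {a'<..<b'}"
  shows "a = a'" "b = b'"
proof -
  have "x \<le> a \<or> b \<le> x" "x \<le> a' \<or> b' \<le> x" if "x \<in> K" for x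
    using assms(1,2) that by (auto simp: gap_def disjoint_iff not_less)
  from this[of a] this[of b] this[of a'] this[of b'] show "a = a'" "b = b'"
    using assms by (auto simp: gap_def)
qed

text \<open>When no point of \<open>K\<close> up to \<open>b\<close> follows \<open>c\<close> within
  distance \<open>d\<close>, the points of \<open>K\<close> in \<open>{c + d..b}\<close> form a
  nonempty closed set, and its infimum ends a gap starting at \<open>c\<close>.\<close>

lemma next_point_exists:
  fixes K :: "real set"
  assumes K: "closed K" and cb: "c \<in> K" "b \<in> K" "c < b"
    and "0 < d" and away: "\<And>t. t \<in> K \<Longrightarrow> c < t \<Longrightarrow> t < c + d \<Longrightarrow> b < t"
  obtains s where "gap K c s" "s \<le> b"
proof -
  let ?T = "K \<inter> {c + d..b}"
  have bd: "c + d \<le> b" using away[of b] cb by force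
  have ne: "?T \<noteq> {}" using bd cb by auto
  have bb: "bdd_below ?T" by (rule bdd_below_mono[of "{c + d..b}"]) auto
  have s: "Inf ?T \<in> ?T"
    by (rule closed_contains_Inf[OF ne bb closed_Int[OF K]]) simp
  have "gap K c (Inf ?T)" unfolding gap_def
  proof (intro conjI equals0I)
    fix t assume t: "t \<in> K \<inter> {c<..<Inf ?T}"
    hence "t \<le> b" using s by auto
    hence "\<not> t < c + d" using away[of t] t by auto
    hence "c + d \<le> t" by simp
    hence "Inf ?T \<le> t" using t \<open>t \<le> b\<close> by (intro cInf_lower bb) auto
    with t show False by simp
  qed (use s cb \<open>0 < d\<close> in auto)
  thus thesis using s by (intro that) auto
qed

text \<open>
  The estimate \<open>norm (D t - D a) \<le> e * (t - a)\<close> propagates across gaps and along short steps, so the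
  supremum of the points of \<open>K\<close> where it holds cannot lie before \<open>b\<close>.
\<close>
lemma constant_if_locally_flat:
  fixes D :: "real \<Rightarrow> 'a::real_normed_vector"
  assumes K: "closed K"
    and flat: "\<And>e. 0 < e \<Longrightarrow> \<exists>d>0. \<forall>a\<in>K. \<forall>b\<in>K. 0 < b - a \<and> b - a < d
      \<longrightarrow> norm (D b - D a) \<le> e * (b - a)"
    and gaps: "\<And>a b. gap K a b \<Longrightarrow> D b = D a"
    and ab: "a \<in> K" "b \<in> K" "a < b"
  shows "D b = D a"
proof -
  have "norm (D b - D a) \<le> e * (b - a)" if e: "0 < e" for e
  proof -
    obtain d where d: "0 < d" and flat': "\<And>s t. s \<in> K \<Longrightarrow> t \<in> K \<Longrightarrow> s \<le> t \<Longrightarrow> t < s + d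
        \<Longrightarrow> norm (D t - D s) \<le> e * (t - s)"
    proof -
      obtain d where d: "0 < d" "\<forall>s\<in>K. \<forall>t\<in>K. 0 < t - s \<and> t - s < d \<longrightarrow> norm (D t - D s) \<le> e * (t - s)"
        using flat[OF e] by blast
      have "norm (D t - D s) \<le> e * (t - s)" if "s \<in> K" "t \<in> K" "s \<le> t" "t < s + d" for s t
        using d(2) that by (cases "s = t") auto
      with d(1) show thesis by (rule that)
    qed
    define S where "S = {t \<in> K \<inter> {a..b}. norm (D t - D a) \<le> e * (t - a)}"
    have step: "t \<in> S" if s: "s \<in> S" and t: "t \<in> K" "s \<le> t" "t \<le> b"
      and st: "norm (D t - D s) \<le> e * (t - s)" for s t
    proof -
      have "norm (D t - D a) \<le> norm (D t - D s) + norm (D s - D a)"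
        using norm_triangle_ineq[of "D t - D s" "D s - D a"] by simp
      also have "\<dots> \<le> e * (t - a)" using s st by (auto simp: S_def algebra_simps)
      finally show ?thesis using s t by (auto simp: S_def)
    qed
    define c where "c = Sup S"
    have aS: "a \<in> S" using ab by (auto simp: S_def)
    have bdd: "bdd_above S" by (rule bdd_above_mono[of "{a..b}"]) (auto simp: S_def)
    have c_ge: "t \<le> c" if "t \<in> S" for t unfolding c_def using that bdd by (rule cSup_upper)
    have cb: "c \<le> b" unfolding c_def using aS by (intro cSup_least) (auto simp: S_def)
    \<comment> \<open>The supremum lies in \<open>K\<close> by closedness. It satisfies the estimate
      as well, by a short step from a point of \<open>S\<close> within \<open>d\<close> of
      it.\<close>
    have "c \<in> closure S" unfolding c_def using aS by (intro closure_contains_Sup bdd) auto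
    hence cK: "c \<in> K" using closure_minimal[OF _ K, of S] by (auto simp: S_def)
    obtain s where s: "s \<in> S" "c - d < s"
      using less_cSupD[of S "c - d"] aS d by (auto simp: c_def)
    have cS: "c \<in> S"
      using s c_ge[OF s(1)] cb cK by (intro step[OF s(1)] flat') (auto simp: S_def)
    have "c = b"
    proof (rule ccontr)
      assume "c \<noteq> b"
      hence lt: "c < b" using cb by simp
      show False
      proof (cases "\<exists>t\<in>K. c < t \<and> t < c + d \<and> t \<le> b")
        case True
        then obtain t where t: "t \<in> K" "c < t" "t < c + d" "t \<le> b" by blast
        hence "t \<in> S" using cK by (intro step[OF cS] flat') auto
        thus False using c_ge t by fastforce
      next
        case False
        obtain t where t: "gap K c t" "t \<le> b"
          by (rule next_point_exists[OF K cK ab(2) lt d(1)]) (use False in force)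
        hence "t \<in> S" using e gaps[OF t(1)] by (intro step[OF cS]) (auto simp: gap_def)
        thus False using c_ge t by (fastforce simp: gap_def)
      qed
    qed
    with cS show ?thesis by (simp add: S_def)
  qed
  hence "norm (D b - D a) / (b - a) \<le> 0 + e" if "0 < e" for e
    using that ab by (simp add: divide_le_eq)
  hence "norm (D b - D a) / (b - a) \<le> 0" by (rule field_le_epsilon)
  thus ?thesis using ab by (simp add: divide_le_0_iff)
qed

text \<open>Subtract an antiderivative \<open>W\<close> of \<open>V\<close> from \<open>F\<close>.
  On \<open>K\<close> the difference is flat to first order, since both have velocity
  \<open>V\<close> there, and it does not change across gaps, so it is constant. The lemma serves
  for the horizontal part and then for the height.\<close>

lemma C1_extension_from_gaps:
  fixes F V :: "real \<Rightarrow> 'a::euclidean_space"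
  assumes K: "compact K"
    and V: "continuous_on UNIV V"
    and whitney: "\<And>e. 0 < e \<Longrightarrow> \<exists>d>0. \<forall>a\<in>K. \<forall>b\<in>K. 0 < b - a \<and> b - a < d
      \<longrightarrow> norm (F b - F a - (b - a) *\<^sub>R V a) \<le> e * (b - a)"
    and gaps: "\<And>a b U. gap K a b \<Longrightarrow> (\<And>t. (U has_vector_derivative V t) (at t))
      \<Longrightarrow> U b - U a = F b - F a"
  obtains U where "\<And>t. (U has_vector_derivative V t) (at t)" "\<And>t. t \<in> K \<Longrightarrow> U t = F t"
proof -
  obtain W where W: "\<And>t. (W has_vector_derivative V t) (at t)"
    using antiderivative_exists[OF V] by blast
  define D where "D t = F t - W t" for t
  have "D b = D a" if ab: "a \<in> K" "b \<in> K" "a < b" for a b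
  proof (rule constant_if_locally_flat[OF compact_imp_closed[OF K] _ _ ab])
    show "D b = D a" if "gap K a b" for a b
      using gaps[OF that W] by (simp add: D_def algebra_simps)
    fix e :: real assume "0 < e"
    hence e: "0 < e / 2" by simp
    obtain d1 where d1: "d1 > 0" "\<forall>a\<in>K. \<forall>b\<in>K. 0 < b - a \<and> b - a < d1
        \<longrightarrow> norm (F b - F a - (b - a) *\<^sub>R V a) \<le> e / 2 * (b - a)"
      using whitney[OF e] by blast
    obtain d2 where d2: "d2 > 0" "\<And>a t. a \<in> K \<Longrightarrow> \<bar>t - a\<bar> < d2 \<Longrightarrow> norm (V t - V a) \<le> e / 2"
      using uniform_linearization[OF K V e] by blast
    have "norm (D b - D a) \<le> e * (b - a)"
      if ab: "a \<in> K" "b \<in> K" "0 < b - a" "b - a < min d1 d2" for a b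
    proof -
      have 1: "norm (F b - F a - (b - a) *\<^sub>R V a) \<le> e / 2 * (b - a)" using d1 ab by simp
      have 2: "norm (W b - W a - (b - a) *\<^sub>R V a) \<le> e / 2 * (b - a)"
        by (rule vector_derivative_deviation[where f' = V])
          (use ab d2(2)[of a] in \<open>auto intro: has_vector_derivative_at_within W simp del: le_divide_eq_numeral1\<close>)
      have "D b - D a = (F b - F a - (b - a) *\<^sub>R V a) - (W b - W a - (b - a) *\<^sub>R V a)"
        by (simp add: D_def)
      also have "norm \<dots> \<le> e / 2 * (b - a) + e / 2 * (b - a)"
        by (rule order_trans[OF norm_triangle_ineq4 add_mono[OF 1 2]])
      finally show ?thesis by (simp add: field_simps)
    qed
    thus "\<exists>d>0. \<forall>a\<in>K. \<forall>b\<in>K. 0 < b - a \<and> b - a < d \<longrightarrow> norm (D b - D a) \<le> e * (b - a)"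
      using d1(1) d2(1) by (intro exI[of _ "min d1 d2"]) auto
  qed
  hence const: "D b = D a" if "a \<in> K" "b \<in> K" for a b
    using that by (cases a b rule: linorder_cases) auto
  \<comment> \<open>For empty \<open>K\<close> this is an arbitrary number, and there is no value to
    match.\<close>
  define k where "k = (SOME k. k \<in> K)"
  have "((\<lambda>t. W t + D k) has_vector_derivative V t) (at t)" for t
    using W[of t] by (auto intro!: derivative_eq_intros)
  moreover have "W t + D k = F t" if "t \<in> K" for t
  proof -
    have "k \<in> K" unfolding k_def using that by (rule someI)
    hence "D k = D t" using const that by blast
    thus ?thesis by (simp add: D_def)
  qed
  ultimately show thesis by (rule that)
qed

text \<open>
  The parabolic bound makes the glued function small near \<open>K\<close> inside the long gaps, the smallness
  hypothesis does so in the short ones.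
\<close>
lemma gap_functions_glue:
  fixes C :: "real \<Rightarrow> real \<Rightarrow> real \<Rightarrow> 'a::real_normed_vector"
  assumes K: "closed K"
    and C: "\<And>a b. gap K a b \<Longrightarrow> continuous_on UNIV (C a b)"
    and bound: "\<And>a b t. gap K a b \<Longrightarrow> t \<in> {a..b}
      \<Longrightarrow> norm (C a b t) \<le> B * ((t - a) / (b - a) * (1 - (t - a) / (b - a)))"
    and small: "\<And>e. 0 < e \<Longrightarrow> \<exists>d>0. \<forall>a b. gap K a b \<and> b - a < d
      \<longrightarrow> (\<forall>t\<in>{a..b}. norm (C a b t) \<le> e)"
  obtains c where "continuous_on UNIV c" "\<And>t. t \<in> K \<Longrightarrow> c t = 0"
    "\<And>a b t. gap K a b \<Longrightarrow> t \<in> {a..b} \<Longrightarrow> c t = C a b t"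
proof -
  define P where "P t p \<longleftrightarrow> gap K (fst p) (snd p) \<and> t \<in> {fst p<..<snd p}" for t p
  define c where "c t = (if \<exists>p. P t p then C (fst (Eps (P t))) (snd (Eps (P t))) t else 0)" for t
  have c_in: "c t = C a b t" if "gap K a b" "t \<in> {a<..<b}" for a b t
  proof -
    have P: "P t (a, b)" using that by (simp add: P_def)
    hence "P t (Eps (P t))" by (rule someI)
    hence "fst (Eps (P t)) = a" "snd (Eps (P t)) = b"
      using gap_unique[OF _ that(1) _ that(2)] by (auto simp: P_def)
    with P show ?thesis by (auto simp: c_def)
  qed
  have c_out: "c t = 0" if "\<And>a b. gap K a b \<Longrightarrow> t \<notin> {a<..<b}" for t
    using that by (auto simp: c_def P_def)
  have c_K: "c t = 0" if "t \<in> K" for t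
    using that by (intro c_out) (auto simp: gap_def)
  have c_gap: "c t = C a b t" if g: "gap K a b" and t: "t \<in> {a..b}" for a b t
  proof (cases "t \<in> {a<..<b}")
    case False
    hence "t = a \<or> t = b" using t by auto
    \<comment> \<open>At the end points the parabolic factor is zero, so \<open>bound\<close> forces
      \<open>C a b t = 0\<close>, the value of \<open>c\<close> on \<open>K\<close>.\<close>
    thus ?thesis using bound[OF g t] g c_K[of a] c_K[of b] by (auto simp: gap_def)
  qed (rule c_in[OF g])
  have "isCont c t" if t: "t \<notin> K" for t
  proof -
    obtain e where e: "0 < e" "ball t e \<subseteq> - K"
      by (rule openE[of "- K" t]) (use K t in \<open>auto simp: open_Compl\<close>)
    \<comment> \<open>A ball that misses \<open>K\<close> contains no end point of a gap, so it lies
      inside any gap that it meets.\<close>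
    have whole: "x \<in> {a<..<b}" if "gap K a b" "s \<in> {a<..<b}" "s \<in> ball t e" "x \<in> ball t e" for a b s x
    proof -
      have "a \<notin> ball t e" "b \<notin> ball t e" using that(1) e(2) unfolding gap_def by blast+
      hence "e \<le> \<bar>t - a\<bar>" "e \<le> \<bar>t - b\<bar>" by (simp_all add: dist_real_def)
      moreover have "\<bar>t - s\<bar> < e" "\<bar>t - x\<bar> < e" "a < s" "s < b"
        using that(2-4) by (simp_all add: dist_real_def)
      ultimately have "a < x" "x < b" by linarith+
      thus ?thesis by simp
    qed
    show ?thesis
    proof (cases "\<exists>a b. gap K a b \<and> t \<in> {a<..<b}")
      case True
      then obtain a b where ab: "gap K a b" "t \<in> {a<..<b}" by blast
      have "isCont (C a b) t" using C[OF ab(1)] by (simp add: continuous_on_eq_continuous_at)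
      moreover have "eventually (\<lambda>x. C a b x = c x) (nhds t)"
        unfolding eventually_nhds using ab c_in[OF ab(1)]
        by (intro exI[of _ "{a<..<b}"]) auto
      hence "isCont (C a b) t \<longleftrightarrow> isCont c t" by (rule isCont_cong)
      ultimately show ?thesis by blast
    next
      case False
      have "c x = 0" if "x \<in> ball t e" for x
        using whole[OF _ _ that, of _ _ t] False e by (intro c_out) auto
      hence "eventually (\<lambda>x. 0 = c x) (nhds t)"
        unfolding eventually_nhds using e by (intro exI[of _ "ball t e"]) auto
      hence "isCont (\<lambda>x. 0 :: 'a) t \<longleftrightarrow> isCont c t" by (rule isCont_cong)
      thus ?thesis by simp
    qed
  qed
  moreover have "isCont c t" if t: "t \<in> K" for t
    unfolding continuous_at_eps_delta
  proof (intro allI impI)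
    fix e :: real assume "0 < e"
    then obtain d where d: "0 < d" "\<And>a b s. gap K a b \<Longrightarrow> b - a < d \<Longrightarrow> s \<in> {a..b} \<Longrightarrow> norm (C a b s) \<le> e / 2"
      using small[of "e / 2"] by auto
    \<comment> \<open>Chosen so that \<open>\<bar>B\<bar> * (r / d) < e\<close>: in a gap of length
      at least \<open>d\<close>, a point within \<open>r\<close> of \<open>t\<close> is at relative
      distance at most \<open>r / d\<close> from an end.\<close>
    define r where "r = e * d / (\<bar>B\<bar> + 1)"
    have r: "0 < r" using \<open>0 < e\<close> d by (simp add: r_def)
    have "norm (c s) < e" if s: "\<bar>s - t\<bar> < r" for s
    proof (cases "\<exists>a b. gap K a b \<and> s \<in> {a<..<b}")
      case True
      then obtain a b where ab: "gap K a b" "s \<in> {a<..<b}" by blast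
      hence cs: "c s = C a b s" by (rule c_in)
      show ?thesis
      proof (cases "b - a < d")
        case True
        thus ?thesis using d(2)[OF ab(1) True, of s] ab \<open>0 < e\<close> cs by auto
      next
        case False
        have "t \<le> a \<or> b \<le> t" using ab t by (auto simp: gap_def disjoint_iff)
        hence near: "s - a < r \<or> b - s < r" using s by auto
        define x where "x = (s - a) / (b - a)"
        have x: "0 \<le> x" "x \<le> 1" using ab by (auto simp: x_def field_simps)
        have one_x: "1 - x = (b - s) / (b - a)" using ab by (auto simp: x_def field_simps)
        have "x * (1 - x) \<le> r / d"
        proof -
          have "(s - a) / (b - a) \<le> r / d \<or> (b - s) / (b - a) \<le> r / d"
            using near
          proof
            assume "s - a < r"
            hence "(s - a) / (b - a) \<le> r / d" using False d ab r by (intro frac_le) auto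
            thus ?thesis ..
          next
            assume "b - s < r"
            hence "(b - s) / (b - a) \<le> r / d" using False d ab r by (intro frac_le) auto
            thus ?thesis ..
          qed
          hence "x \<le> r / d \<or> 1 - x \<le> r / d" unfolding one_x by (simp only: x_def)
          moreover have "x * (1 - x) \<le> x" using x by (intro mult_left_le) auto
          moreover have "x * (1 - x) \<le> 1 - x" using x by (intro mult_left_le_one_le) auto
          ultimately show ?thesis by linarith
        qed
        have "norm (C a b s) \<le> B * (x * (1 - x))" using bound[OF ab(1), of s] ab by (simp add: x_def)
        also have "\<dots> \<le> \<bar>B\<bar> * (r / d)"
          using \<open>x * (1 - x) \<le> r / d\<close> x by (intro mult_mono) auto
        also have "\<dots> = e * (\<bar>B\<bar> / (\<bar>B\<bar> + 1))" using d by (simp add: r_def)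
        also have "\<dots> < e * 1" using \<open>0 < e\<close> by (intro mult_strict_left_mono) (auto simp: divide_less_eq)
        finally show ?thesis by (simp add: cs)
      qed
    next
      case False
      thus ?thesis using c_out[of s] \<open>0 < e\<close> by auto
    qed
    thus "\<exists>r>0. \<forall>s. dist s t < r \<longrightarrow> dist (c s) (c t) < e"
      using r c_K[OF t] by (intro exI[of _ r]) (auto simp: dist_real_def)
  qed
  ultimately have "continuous_on UNIV c" by (auto simp: continuous_on_eq_continuous_at)
  thus thesis using c_K c_gap by (rule that)
qed

section \<open>Correcting displacement and area on a gap\<close>

text \<open>
  With \<open>r = s (1 - s)\<close> and \<open>m = 1 - 2 s\<close>, so that \<open>r' = m\<close> and \<open>m\<^sup>2 = 1 - 4 r\<close>, the loop is
  \<open>(r\<^sup>2 m, 3 r\<^sup>2 - 14 r\<^sup>3) = (r\<^sup>3 / 3, r\<^sup>3 m)'\<close>, and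
  \<open>loop1' loop2 - loop1 loop2' = 8 r\<^sup>4 - 28 r\<^sup>5\<close> has integral \<open>1 / 385\<close> over \<open>[0, 1]\<close>.
\<close>
definition loop1 :: "real \<Rightarrow> real"
  where "loop1 s = (s * (1 - s))\<^sup>2 * (1 - 2 * s)"

definition loop1' :: "real \<Rightarrow> real"
  where "loop1' s = 2 * (s * (1 - s)) * (1 - 5 * (s * (1 - s)))"

definition loop2 :: "real \<Rightarrow> real"
  where "loop2 s = (s * (1 - s))\<^sup>2 * (3 - 14 * (s * (1 - s)))"

definition loop2' :: "real \<Rightarrow> real"
  where "loop2' s = 6 * (s * (1 - s)) * (1 - 7 * (s * (1 - s))) * (1 - 2 * s)"

lemma loop_derivative:
  "(loop1 has_field_derivative loop1' s) (at s within S)"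
  "(loop2 has_field_derivative loop2' s) (at s within S)"
  unfolding loop1_def[abs_def] loop1'_def loop2_def[abs_def] loop2'_def
  by (auto intro!: derivative_eq_intros simp: algebra_simps power2_eq_square)

lemma loop_antiderivative:
  "((\<lambda>s. (s * (1 - s)) ^ 3 / 3) has_field_derivative loop1 s) (at s within S)"
  "((\<lambda>s. (s * (1 - s)) ^ 3 * (1 - 2 * s)) has_field_derivative loop2 s) (at s within S)"
  unfolding loop1_def loop2_def
  by (auto intro!: derivative_eq_intros simp: field_simps power2_eq_square power3_eq_cube)

text \<open>As \<open>(1 - 2 * s) * r ^ k\<close> has derivative
  \<open>k * r ^ (k - 1) - (4 * k + 2) * r ^ k\<close>, the coefficients result from eliminating
  powers of \<open>r\<close> in \<open>8 * r ^ 4 - 28 * r ^ 5\<close> from the top. The constant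
  that remains gives \<open>s / 385\<close>; all other terms vanish at both ends.\<close>

definition loop_area :: "real \<Rightarrow> real"
  where "loop_area s = (let r = s * (1 - s) in
    s / 385 + (1 - 2 * s) * (- r / 385 - 3 * r ^ 2 / 385 - 2 * r ^ 3 / 77 - r ^ 4 / 11 + 14 * r ^ 5 / 11))"

lemma loop_area_derivative:
  "(loop_area has_field_derivative loop1' s * loop2 s - loop1 s * loop2' s) (at s within S)"
proof -
  define r where "r = s * (1 - s)"
  define m where "m = 1 - 2 * s"
  have m2: "m * m = 1 - 4 * r" by (simp add: m_def r_def algebra_simps)
  have "((\<lambda>s. s / 385 + (1 - 2 * s) * (- (s * (1 - s)) / 385 - 3 * (s * (1 - s)) ^ 2 / 385
      - 2 * (s * (1 - s)) ^ 3 / 77 - (s * (1 - s)) ^ 4 / 11 + 14 * (s * (1 - s)) ^ 5 / 11))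
      has_field_derivative (1 / 385 - 2 * (- r / 385 - 3 * r ^ 2 / 385 - 2 * r ^ 3 / 77 - r ^ 4 / 11 + 14 * r ^ 5 / 11)
        + m * (m * (- 1 / 385 - 6 * r / 385 - 6 * r ^ 2 / 77 - 4 * r ^ 3 / 11 + 70 * r ^ 4 / 11)))) (at s within S)"
    by (auto intro!: derivative_eq_intros simp: r_def m_def field_simps)
  \<comment> \<open>Trading \<open>m * m\<close> for \<open>1 - 4 * r\<close> leaves an identity
    between polynomials in \<open>r\<close> alone.\<close>
  also have "m * (m * (- 1 / 385 - 6 * r / 385 - 6 * r ^ 2 / 77 - 4 * r ^ 3 / 11 + 70 * r ^ 4 / 11))
    = (1 - 4 * r) * (- 1 / 385 - 6 * r / 385 - 6 * r ^ 2 / 77 - 4 * r ^ 3 / 11 + 70 * r ^ 4 / 11)"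
    by (simp add: mult.assoc[symmetric] m2)
  also have "1 / 385 - 2 * (- r / 385 - 3 * r ^ 2 / 385 - 2 * r ^ 3 / 77 - r ^ 4 / 11 + 14 * r ^ 5 / 11) + \<dots>
    = 8 * r ^ 4 - 28 * r ^ 5"
    by (simp add: field_simps eval_nat_numeral)
  also have "8 * r ^ 4 - 28 * r ^ 5
      = 2 * r * (1 - 5 * r) * (r\<^sup>2 * (3 - 14 * r)) - 6 * r\<^sup>2 * r * (1 - 7 * r) * (1 - 4 * r)"
    by (simp add: field_simps eval_nat_numeral)
  also have "\<dots> = 2 * r * (1 - 5 * r) * (r\<^sup>2 * (3 - 14 * r)) - 6 * r\<^sup>2 * r * (1 - 7 * r) * (m * m)"
    by (simp only: m2)
  also have "\<dots> = loop1' s * loop2 s - loop1 s * loop2' s"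
    by (simp add: loop1_def loop1'_def loop2_def loop2'_def r_def[symmetric] m_def[symmetric])
  finally show ?thesis by (simp add: loop_area_def[abs_def] Let_def)
qed

lemma parabola_bounds:
  fixes s :: real
  assumes "s \<in> {0..1}"
  shows "0 \<le> s * (1 - s)" "s * (1 - s) \<le> 1 / 4"
proof -
  show "0 \<le> s * (1 - s)" using assms by auto
  have "0 \<le> (s - 1 / 2)\<^sup>2" by simp
  thus "s * (1 - s) \<le> 1 / 4" by (simp add: power2_eq_square algebra_simps)
qed

text \<open>The quarter offsets a factor four in the velocity deviation when the interaction with
  the loop is estimated. The factor \<open>s * (1 - s)\<close>, present in both derivatives, gives
  the parabolic bound that the gluing requires.\<close>

lemma loop_bounds:
  assumes "s \<in> {0..1}"
  shows "\<bar>loop1 s\<bar> + \<bar>loop2 s\<bar> \<le> 1 / 4"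
    and "\<bar>loop1' s\<bar> + \<bar>loop2' s\<bar> \<le> 8 * (s * (1 - s))"
proof -
  define r where "r = s * (1 - s)"
  have r: "0 \<le> r" "r \<le> 1 / 4" using parabola_bounds[OF assms] by (simp_all add: r_def)
  have r2: "r\<^sup>2 \<le> 1 / 16" using power_mono[OF r(2,1), of 2] by (simp add: power2_eq_square)
  have m: "\<bar>1 - 2 * s\<bar> \<le> 1" using assms by auto
  have "\<bar>loop1 s\<bar> \<le> 1 / 16 * 1"
    unfolding loop1_def r_def[symmetric] abs_mult using r2 m by (intro mult_mono) auto
  moreover have "\<bar>loop2 s\<bar> \<le> 1 / 16 * 3"
    unfolding loop2_def r_def[symmetric] abs_mult using r2 r by (intro mult_mono) auto
  ultimately show "\<bar>loop1 s\<bar> + \<bar>loop2 s\<bar> \<le> 1 / 4" by simp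
  have "\<bar>loop1' s\<bar> \<le> (2 * r) * 1"
    unfolding loop1'_def r_def[symmetric] abs_mult[of "2 * r"] using r by (intro mult_mono) auto
  moreover have "\<bar>loop2' s\<bar> \<le> (6 * r) * 1 * 1"
    unfolding loop2'_def r_def[symmetric] abs_mult[of "6 * r * _"] abs_mult[of "6 * r"]
    using r m by (intro mult_mono) auto
  ultimately show "\<bar>loop1' s\<bar> + \<bar>loop2' s\<bar> \<le> 8 * (s * (1 - s))" by (simp add: r_def)
qed

text \<open>The first summand bounds the bump, with profile \<open>6 * (s * (1 - s))\<close> and a
  vector of norm at most \<open>2 * e\<close>. The second is the factor 8 from the loop velocity
  times the bound on the loop size; 385 is the reciprocal of the loop area. The sum tends to zero
  with \<open>e\<close>.\<close>

definition correction_bound :: "real \<Rightarrow> real \<Rightarrow> real"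
  where "correction_bound M e =
    12 * e + 8 * (385 * (2 * e + sqrt ((e + 8 * M * e + 16 * e\<^sup>2) / 385)))"

text \<open>
  The sign \<open>\<sigma>\<close> is the orientation of the loop; the linear coefficient depends on it since reversing the
  loop changes its interaction with the given curve.
\<close>
lemma signed_quadratic_root:
  fixes d k :: real and I :: "real \<Rightarrow> real"
  assumes k: "0 < k"
  obtains \<sigma> x where "\<bar>\<sigma>\<bar> = 1" "\<sigma> * k * x\<^sup>2 + 2 * x * I \<sigma> = d"
    "\<bar>x\<bar> \<le> (2 * \<bar>I \<sigma>\<bar> + sqrt (k * \<bar>d\<bar>)) / k"
proof -
  \<comment> \<open>Taking the sign of \<open>d\<close> turns the constant term into
    \<open>\<bar>d\<bar>\<close>, so the discriminant \<open>y\<^sup>2 + k * \<bar>d\<bar>\<close>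
    is nonnegative and a real root exists.\<close>
  define \<sigma> :: real where "\<sigma> = (if 0 \<le> d then 1 else - 1)"
  define y where "y = \<sigma> * I \<sigma>"
  define R where "R = sqrt (y\<^sup>2 + k * \<bar>d\<bar>)"
  define x where "x = (R - y) / k"
  have \<sigma>: "\<bar>\<sigma>\<bar> = 1" "\<sigma> * \<sigma> = 1" "\<sigma> * \<bar>d\<bar> = d" by (auto simp: \<sigma>_def)
  have y: "\<bar>y\<bar> = \<bar>I \<sigma>\<bar>" by (simp add: y_def abs_mult \<sigma>)
  have R2: "R\<^sup>2 = y\<^sup>2 + k * \<bar>d\<bar>" using k by (simp add: R_def)
  have "k * x\<^sup>2 + 2 * x * y = (R\<^sup>2 - y\<^sup>2) / k"
    using k by (simp add: x_def field_simps power2_eq_square)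
  also have "\<dots> = \<bar>d\<bar>" using k by (simp add: R2)
  finally have root: "k * x\<^sup>2 + 2 * x * y = \<bar>d\<bar>" .
  have "I \<sigma> = \<sigma> * y" by (simp add: y_def mult.assoc[symmetric] \<sigma>)
  hence "\<sigma> * k * x\<^sup>2 + 2 * x * I \<sigma> = \<sigma> * (k * x\<^sup>2 + 2 * x * y)" by (simp add: algebra_simps)
  hence eq: "\<sigma> * k * x\<^sup>2 + 2 * x * I \<sigma> = d" by (simp only: root \<sigma>)
  have "R \<le> sqrt (y\<^sup>2) + sqrt (k * \<bar>d\<bar>)" unfolding R_def using k by (intro sqrt_add_le_add_sqrt) auto
  moreover have "0 \<le> R" using k by (simp add: R_def)
  ultimately have "\<bar>R - y\<bar> \<le> 2 * \<bar>I \<sigma>\<bar> + sqrt (k * \<bar>d\<bar>)" using y by simp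
  hence "\<bar>x\<bar> \<le> (2 * \<bar>I \<sigma>\<bar> + sqrt (k * \<bar>d\<bar>)) / k"
    using k by (simp add: x_def divide_right_mono)
  with \<sigma>(1) eq show thesis by (rule that)
qed

text \<open>
  The correction does not depend on \<open>w\<close>, \<open>M\<close> and \<open>e\<close>: for one and the same correction the bound is used
  with a crude \<open>e\<close> common to all gaps and with small \<open>e\<close> on short gaps.
\<close>
lemma gap_correction:
  fixes v :: "real \<Rightarrow> (real \<times> real) ^ 'n::finite" and p \<Delta> :: "(real \<times> real) ^ 'n" and T :: real
  assumes v: "continuous_on UNIV v" and ab: "a < b"
  shows "\<exists>c. continuous_on UNIV c \<and>
    (\<forall>U. (\<forall>t\<in>{a..b}. (U has_vector_derivative v t + c t) (at t within {a..b})) \<and> U a = p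
      \<longrightarrow> U b = p + \<Delta> \<and> integral {a..b} (\<lambda>t. symp (v t + c t) (U t)) = T) \<and>
    (\<forall>w M e. (\<forall>t\<in>{a..b}. norm (v t - w) \<le> e) \<and> norm w \<le> M \<and>
        norm (\<Delta> - (b - a) *\<^sub>R w) \<le> e * (b - a) \<and> \<bar>T - symp \<Delta> p\<bar> \<le> e * (b - a)\<^sup>2
      \<longrightarrow> (\<forall>t\<in>{a..b}. norm (c t)
          \<le> correction_bound M e * ((t - a) / (b - a) * (1 - (t - a) / (b - a)))))"
proof -
  define L where "L = b - a"
  have L: "0 < L" using ab by (simp add: L_def)
  define s where "s t = (t - a) / L" for t
  have s_ends: "s a = 0" "s b = 1" using L by (simp_all add: s_def L_def)
  have s_in: "s t \<in> {0..1}" if "t \<in> {a..b}" for t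
    using that L by (auto simp: s_def L_def field_simps)
  have ds: "(s has_field_derivative 1 / L) (at t within S)" for t S
    unfolding s_def[abs_def] using L by (auto intro!: derivative_eq_intros)
  have ds_comp: "((\<lambda>t. g (s t)) has_field_derivative g' * (1 / L)) (at t within S)"
    if "\<And>S. (g has_field_derivative g') (at (s t) within S)" for g g' t S
    using DERIV_chain2[OF that ds] .
  obtain P where P: "\<And>t. (P has_vector_derivative v t) (at t)"
    using antiderivative_exists[OF v] by blast
  have P': "(P has_vector_derivative v t) (at t within S)" for t S
    by (rule has_vector_derivative_at_within[OF P])
  have d_scale: "((\<lambda>t. h t *\<^sub>R k) has_vector_derivative h' *\<^sub>R k) (at t within S)"
    if "(h has_field_derivative h') (at t within S)" for h h' t S and k :: "(real \<times> real) ^ 'n"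
    using has_vector_derivative_scaleR[OF that has_vector_derivative_const] by simp
  \<comment> \<open>The missing displacement per unit length. Since \<open>6 * (s * (1 - s))\<close>
    has integral one over \<open>{0..1}\<close>, the bump in \<open>f0\<close> supplies exactly what
    is missing; \<open>U0\<close> is the resulting curve from \<open>p\<close>.\<close>
  define \<kappa> where "\<kappa> = (1 / L) *\<^sub>R (\<Delta> - (P b - P a))"
  define f0 where "f0 t = v t + (6 * (s t * (1 - s t))) *\<^sub>R \<kappa>" for t
  define U0 where "U0 t = p + (P t - P a) + (L * (3 * (s t)\<^sup>2 - 2 * (s t) ^ 3)) *\<^sub>R \<kappa>" for t
  have dU0: "(U0 has_vector_derivative f0 t) (at t within S)" for t S
  proof -
    have "((\<lambda>t. L * (3 * (s t)\<^sup>2 - 2 * (s t) ^ 3)) has_field_derivative 6 * (s t * (1 - s t))) (at t within S)"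
      using L by (auto intro!: derivative_eq_intros ds simp: field_simps power2_eq_square)
    hence "((\<lambda>t. p + ((P t - P a) + (L * (3 * (s t)\<^sup>2 - 2 * (s t) ^ 3)) *\<^sub>R \<kappa>))
        has_vector_derivative 0 + (v t - 0 + (6 * (s t * (1 - s t))) *\<^sub>R \<kappa>)) (at t within S)"
      by (intro has_vector_derivative_add has_vector_derivative_diff has_vector_derivative_const P' d_scale)
    thus ?thesis unfolding U0_def[abs_def] f0_def by (simp add: add.assoc)
  qed
  have U0_ends: "U0 a = p" "U0 b = p + \<Delta>"
    using L by (simp_all add: U0_def s_ends \<kappa>_def)
  \<comment> \<open>One coordinate plane is enough for the loop, and the index type has at least one
    element.\<close>
  define j0 where "j0 = (undefined :: 'n)"
  define e1 where "e1 = (axis j0 (1, 0) :: (real \<times> real) ^ 'n)"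
  define e2 where "e2 = (axis j0 (0, 1) :: (real \<times> real) ^ 'n)"
  have norms: "norm e1 = 1" "norm e2 = 1" by (simp_all add: e1_def e2_def norm_eq_sqrt_inner inner_axis_axis inner_prod_def)
  have e12: "symp e1 e2 = 1"
  proof -
    have "symp e1 e2 = (\<Sum>j\<in>UNIV. if j = j0 then 1 else 0)"
      unfolding symp_def by (rule sum.cong) (auto simp: e1_def e2_def axis_def)
    thus ?thesis by simp
  qed
  have e21: "symp e2 e1 = - 1" using symp_skew[of e2 e1] e12 by simp
  define Q where "Q \<sigma> t = loop1 (s t) *\<^sub>R e1 + (\<sigma> * loop2 (s t)) *\<^sub>R e2" for \<sigma> t
  define Q' where "Q' \<sigma> t = loop1' (s t) *\<^sub>R e1 + (\<sigma> * loop2' (s t)) *\<^sub>R e2" for \<sigma> t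
  have dQ: "(Q \<sigma> has_vector_derivative (1 / L) *\<^sub>R Q' \<sigma> t) (at t within S)" for \<sigma> t S
    unfolding Q_def[abs_def] Q'_def
    using has_vector_derivative_add[OF d_scale[OF ds_comp[OF loop_derivative(1)]]
        d_scale[OF DERIV_cmult[OF ds_comp[OF loop_derivative(2)]]]]
    by (simp add: scaleR_add_right)
  have Q_ends: "Q \<sigma> a = 0" "Q \<sigma> b = 0" for \<sigma>
    by (simp_all add: Q_def s_ends loop1_def loop2_def)
  have norm_Q: "norm (Q \<sigma> t) \<le> 1 / 4" if "\<bar>\<sigma>\<bar> = 1" "t \<in> {a..b}" for \<sigma> t
  proof -
    have "norm (Q \<sigma> t) \<le> \<bar>loop1 (s t)\<bar> + \<bar>loop2 (s t)\<bar>"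
      unfolding Q_def by (rule order_trans[OF norm_triangle_ineq]) (simp add: norms abs_mult that)
    thus ?thesis using loop_bounds(1)[OF s_in[OF that(2)]] by linarith
  qed
  have norm_Q': "norm (Q' \<sigma> t) \<le> 8 * (s t * (1 - s t))" if "\<bar>\<sigma>\<bar> = 1" "t \<in> {a..b}" for \<sigma> t
  proof -
    have "norm (Q' \<sigma> t) \<le> \<bar>loop1' (s t)\<bar> + \<bar>loop2' (s t)\<bar>"
      unfolding Q'_def by (rule order_trans[OF norm_triangle_ineq]) (simp add: norms abs_mult that)
    thus ?thesis using loop_bounds(2)[OF s_in[OF that(2)]] by linarith
  qed
  \<comment> \<open>The centre of mass is zero, so a constant velocity has no net interaction with
    the loop.\<close>
  have int_Q: "(Q \<sigma> has_integral 0) {a..b}" for \<sigma>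
  proof -
    define R where "R t = (L * ((s t * (1 - s t)) ^ 3 / 3)) *\<^sub>R e1
        + (\<sigma> * L * ((s t * (1 - s t)) ^ 3 * (1 - 2 * s t))) *\<^sub>R e2" for t
    have R1: "((\<lambda>t. L * ((s t * (1 - s t)) ^ 3 / 3)) has_field_derivative loop1 (s t)) (at t within {a..b})" for t
      using DERIV_cmult[OF ds_comp[OF loop_antiderivative(1)], where c = L] L by simp
    have R2: "((\<lambda>t. \<sigma> * L * ((s t * (1 - s t)) ^ 3 * (1 - 2 * s t))) has_field_derivative \<sigma> * loop2 (s t)) (at t within {a..b})" for t
      using DERIV_cmult[OF ds_comp[OF loop_antiderivative(2)], where c = "\<sigma> * L"] L by simp
    have "(Q \<sigma> has_integral (R b - R a)) {a..b}"
    proof (rule fundamental_theorem_of_calculus)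
      show "(R has_vector_derivative Q \<sigma> t) (at t within {a..b})" for t
        unfolding R_def[abs_def] Q_def
        by (intro has_vector_derivative_add d_scale R1 R2)
    qed (use ab in simp)
    thus ?thesis by (simp add: R_def s_ends)
  qed
  have int_QQ': "((\<lambda>t. symp (Q' \<sigma> t) (Q \<sigma> t)) has_integral L * \<sigma> / 385) {a..b}" for \<sigma>
  proof -
    have "((\<lambda>t. \<sigma> * L * loop_area (s t)) has_vector_derivative symp (Q' \<sigma> t) (Q \<sigma> t)) (at t within {a..b})" for t
    proof -
      have "symp (Q' \<sigma> t) (Q \<sigma> t)
          = \<sigma> * (loop1' (s t) * loop2 (s t) - loop1 (s t) * loop2' (s t))"
        by (simp add: Q_def Q'_def symp_linear_simps e12 e21 algebra_simps)
      with DERIV_cmult[OF ds_comp[OF loop_area_derivative], where c = "\<sigma> * L"] L show ?thesis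
        by (simp add: has_real_derivative_iff_has_vector_derivative[symmetric])
    qed
    hence "((\<lambda>t. symp (Q' \<sigma> t) (Q \<sigma> t)) has_integral
        (\<sigma> * L * loop_area (s b) - \<sigma> * L * loop_area (s a))) {a..b}"
      using ab by (intro fundamental_theorem_of_calculus) auto
    thus ?thesis by (simp add: s_ends loop_area_def mult.commute)
  qed
  have cont_s: "continuous_on S s" for S unfolding s_def[abs_def] using L by (intro continuous_intros) auto
  have cont_f0: "continuous_on S f0" for S
    unfolding f0_def[abs_def]
    by (intro continuous_intros cont_s continuous_on_subset[OF v]) auto
  have cont_vd: "continuous_on S g" if "\<And>t. (g has_vector_derivative g' t) (at t within S)"
    for S and g g' :: "real \<Rightarrow> (real \<times> real) ^ 'n"
    using that by (auto simp: continuous_on_eq_continuous_within intro: has_vector_derivative_continuous)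
  have cont_U0: "continuous_on S U0" for S by (rule cont_vd[OF dU0])
  have cont_Q: "continuous_on S (Q \<sigma>)" for S \<sigma> by (rule cont_vd[OF dQ])
  have cont_Q': "continuous_on S (Q' \<sigma>)" for S \<sigma>
    unfolding Q'_def[abs_def] loop1'_def loop2'_def by (intro continuous_intros cont_s)
  define I where "I \<sigma> = integral {a..b} (\<lambda>t. symp (f0 t) (Q \<sigma> t)) / L" for \<sigma>
  have int_I: "((\<lambda>t. symp (f0 t) (Q \<sigma> t)) has_integral L * I \<sigma>) {a..b}" for \<sigma>
    using integrable_integral[OF integrable_continuous_real[OF symp.continuous_on[OF cont_f0 cont_Q]]] L
    by (simp add: I_def)
  define A0 where "A0 = integral {a..b} (\<lambda>t. symp (f0 t) (U0 t))"
  have int_A0: "((\<lambda>t. symp (f0 t) (U0 t)) has_integral A0) {a..b}"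
    using integrable_integral[OF integrable_continuous_real[OF symp.continuous_on[OF cont_f0 cont_U0]]]
    by (simp add: A0_def)
  \<comment> \<open>Adding the loop with factor \<open>L * x\<close> changes the area by
    \<open>L\<^sup>2\<close> times the left-hand side of \<open>root\<close>, so \<open>x\<close> is
    solved from the relative area defect.\<close>
  obtain \<sigma> x where \<sigma>: "\<bar>\<sigma>\<bar> = 1"
    and root: "\<sigma> * (1 / 385) * x\<^sup>2 + 2 * x * I \<sigma> = (T - A0) / L\<^sup>2"
    and x: "\<bar>x\<bar> \<le> (2 * \<bar>I \<sigma>\<bar> + sqrt (1 / 385 * \<bar>(T - A0) / L\<^sup>2\<bar>)) / (1 / 385)"
    by (rule signed_quadratic_root[of "1 / 385" I "(T - A0) / L\<^sup>2"]) auto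
  define c where "c t = (6 * (s t * (1 - s t))) *\<^sub>R \<kappa> + x *\<^sub>R Q' \<sigma> t" for t
  have vc: "v t + c t = f0 t + x *\<^sub>R Q' \<sigma> t" for t by (simp add: c_def f0_def)
  have cont_c: "continuous_on UNIV c"
    unfolding c_def[abs_def] by (intro continuous_intros cont_s cont_Q')
  have target: "U b = p + \<Delta> \<and> integral {a..b} (\<lambda>t. symp (v t + c t) (U t)) = T"
    if dU: "\<And>t. t \<in> {a..b} \<Longrightarrow> (U has_vector_derivative v t + c t) (at t within {a..b})"
      and Ua: "U a = p" for U
  proof -
    have U_eq: "U t = U0 t + (L * x) *\<^sub>R Q \<sigma> t" if t: "t \<in> {a..b}" for t
    proof -
      let ?D = "\<lambda>t. U t - (U0 t + (L * x) *\<^sub>R Q \<sigma> t)"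
      have d: "(?D has_vector_derivative 0) (at t within {a..b})" if "t \<in> {a..b}" for t
      proof -
        have "(?D has_vector_derivative
            (v t + c t) - (f0 t + (L * x) *\<^sub>R ((1 / L) *\<^sub>R Q' \<sigma> t))) (at t within {a..b})"
          by (intro derivative_intros has_vector_derivative_diff has_vector_derivative_add dU that dU0
              bounded_linear.has_vector_derivative[OF bounded_linear_scaleR_right] dQ)
        thus ?thesis using L by (simp add: vc)
      qed
      have "norm (?D t - ?D a - (t - a) *\<^sub>R 0) \<le> 0 * (t - a)"
        by (rule vector_derivative_deviation[OF d _ t]) auto
      thus ?thesis by (simp add: Ua U0_ends Q_ends)
    qed
    \<comment> \<open>Integration by parts: the mixed term
      \<open>x * symp (Q' \<sigma> t) (U0 t)\<close> is a second copy of
      \<open>L * x * symp (f0 t) (Q \<sigma> t)\<close> plus the derivative of \<open>?G\<close>,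
      which integrates to zero because the loop is closed. Hence the factor two in the
      quadratic.\<close>
    let ?G = "\<lambda>t. L * x * symp (Q \<sigma> t) (U0 t)"
    let ?G' = "\<lambda>t. L * x * (symp ((1 / L) *\<^sub>R Q' \<sigma> t) (U0 t) + symp (Q \<sigma> t) (f0 t))"
    have "(?G has_vector_derivative ?G' t) (at t within {a..b})" for t
      using DERIV_cmult[OF symp_has_vector_derivative[OF dQ dU0,
            unfolded has_real_derivative_iff_has_vector_derivative[symmetric]], where c = "L * x"]
      by (simp add: has_real_derivative_iff_has_vector_derivative)
    hence "(?G' has_integral (?G b - ?G a)) {a..b}"
      using ab by (intro fundamental_theorem_of_calculus) auto
    hence int_G: "(?G' has_integral 0) {a..b}"
      by (simp add: Q_ends symp.zero_left)
    have "A0 + 2 * L * x * (L * I \<sigma>) + L * x\<^sup>2 * (L * \<sigma> / 385) + 0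
        = A0 + L\<^sup>2 * (\<sigma> * (1 / 385) * x\<^sup>2 + 2 * x * I \<sigma>)"
      by (simp add: algebra_simps power2_eq_square)
    also have "\<dots> = T" unfolding root using L by simp
    finally have total: "A0 + 2 * L * x * (L * I \<sigma>) + L * x\<^sup>2 * (L * \<sigma> / 385) + 0 = T" .
    have split: "symp (v t + c t) (U t) = symp (f0 t) (U0 t) + 2 * L * x * symp (f0 t) (Q \<sigma> t)
          + L * x\<^sup>2 * symp (Q' \<sigma> t) (Q \<sigma> t) + ?G' t" if "t \<in> {a..b}" for t
      using L symp_skew[of "Q \<sigma> t" "f0 t"]
      unfolding vc U_eq[OF that] by (simp add: symp_linear_simps algebra_simps power2_eq_square)
    have "((\<lambda>t. symp (f0 t) (U0 t) + 2 * L * x * symp (f0 t) (Q \<sigma> t)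
          + L * x\<^sup>2 * symp (Q' \<sigma> t) (Q \<sigma> t) + ?G' t)
        has_integral A0 + 2 * L * x * (L * I \<sigma>) + L * x\<^sup>2 * (L * \<sigma> / 385) + 0) {a..b}"
      by (intro has_integral_add has_integral_mult_right int_A0 int_I int_QQ' int_G)
    hence "((\<lambda>t. symp (v t + c t) (U t)) has_integral T) {a..b}"
      unfolding total by (rule has_integral_eq[rotated]) (simp only: split)
    moreover have "U b = p + \<Delta>" using U_eq[of b] ab by (simp add: U0_ends Q_ends)
    ultimately show ?thesis by (simp add: integral_unique)
  qed
  have bound: "norm (c t) \<le> correction_bound M e * (s t * (1 - s t))"
    if vw: "\<And>t. t \<in> {a..b} \<Longrightarrow> norm (v t - w) \<le> e" and w: "norm w \<le> M"
      and \<Delta>: "norm (\<Delta> - L *\<^sub>R w) \<le> e * L" and T: "\<bar>T - symp \<Delta> p\<bar> \<le> e * L\<^sup>2"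
      and t: "t \<in> {a..b}" for w M e t
  proof -
    have e0: "0 \<le> e" using vw[OF t] norm_ge_zero order_trans by blast
    have "norm (P b - P a - (b - a) *\<^sub>R w) \<le> e * (b - a)"
      by (rule vector_derivative_deviation[OF P' vw]) (use ab in auto)
    hence Pw: "norm (P b - P a - L *\<^sub>R w) \<le> e * L" by (simp add: L_def)
    have "norm (\<Delta> - (P b - P a)) \<le> norm (\<Delta> - L *\<^sub>R w) + norm (P b - P a - L *\<^sub>R w)"
      using norm_triangle_ineq4[of "\<Delta> - L *\<^sub>R w" "P b - P a - L *\<^sub>R w"] by simp
    also have "\<dots> \<le> 2 * e * L" using \<Delta> Pw by simp
    finally have \<kappa>: "norm \<kappa> \<le> 2 * e"
      using L unfolding \<kappa>_def norm_scaleR by (simp add: pos_divide_le_eq)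
    \<comment> \<open>One \<open>e\<close> comes from \<open>v\<close> and \<open>3 * e\<close> from
      the bump, whose profile is at most \<open>6 / 4\<close>.\<close>
    have f0w: "norm (f0 t - w) \<le> 4 * e" if t: "t \<in> {a..b}" for t
    proof -
      have "norm ((6 * (s t * (1 - s t))) *\<^sub>R \<kappa>) = 6 * (s t * (1 - s t)) * norm \<kappa>"
        unfolding norm_scaleR by (subst abs_of_nonneg) (use parabola_bounds(1)[OF s_in[OF t]] in simp_all)
      also have "\<dots> \<le> 6 * (1 / 4) * (2 * e)"
        using parabola_bounds[OF s_in[OF t]] \<kappa> by (intro mult_mono) auto
      finally have "norm ((6 * (s t * (1 - s t))) *\<^sub>R \<kappa>) \<le> 3 * e" by simp
      moreover have split: "f0 t - w = (v t - w) + (6 * (s t * (1 - s t))) *\<^sub>R \<kappa>" by (simp add: f0_def)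
      ultimately show ?thesis
        unfolding split using norm_triangle_ineq[of "v t - w" "(6 * (s t * (1 - s t))) *\<^sub>R \<kappa>"] vw[OF t] by linarith
    qed
    \<comment> \<open>As the loop has centre of mass zero, \<open>f0\<close> may be replaced by
      \<open>f0 - w\<close> under the integral.\<close>
    have "\<bar>I \<sigma>\<bar> \<le> e"
    proof -
      have "((\<lambda>t. symp w (Q \<sigma> t)) has_integral symp w 0) {a..b}"
        using has_integral_linear[OF int_Q symp.bounded_linear_right] by (simp add: o_def)
      from has_integral_diff[OF int_I this, of \<sigma>]
      have "((\<lambda>t. symp (f0 t - w) (Q \<sigma> t)) has_integral L * I \<sigma>) {a..b}"
        by (simp add: symp.diff_left symp.zero_right)
      hence "norm (L * I \<sigma>) \<le> e * measure lborel {a..b}"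
      proof (rule has_integral_bound_real[where S = "{}", unfolded Diff_empty, OF e0 finite.emptyI])
        fix t assume t: "t \<in> {a..b}"
        have "\<bar>symp (f0 t - w) (Q \<sigma> t)\<bar> \<le> norm (f0 t - w) * norm (Q \<sigma> t)" by (rule abs_symp_le)
        also have "\<dots> \<le> (4 * e) * (1 / 4)"
          using f0w[OF t] norm_Q[OF \<sigma> t] e0 by (intro mult_mono) auto
        finally show "norm (symp (f0 t - w) (Q \<sigma> t)) \<le> e" by simp
      qed
      thus ?thesis using L ab by (simp add: abs_mult L_def mult.commute)
    qed
    \<comment> \<open>Measured from its starting point, \<open>U0\<close> has area
      \<open>A0 - symp \<Delta> p\<close>, which the velocity estimate with \<open>4 * e\<close> for
      \<open>e\<close> makes second order in \<open>L\<close>. The hypothesis on \<open>T\<close>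
      adds the single \<open>e\<close>.\<close>
    moreover have "\<bar>(T - A0) / L\<^sup>2\<bar> \<le> e + 8 * M * e + 16 * e\<^sup>2"
    proof -
      have "(f0 has_integral (U0 b - U0 a)) {a..b}"
        using ab by (intro fundamental_theorem_of_calculus dU0) auto
      hence "((\<lambda>t. symp (f0 t) p) has_integral symp \<Delta> p) {a..b}"
        using has_integral_linear[OF _ symp.bounded_linear_left, of f0] by (simp add: o_def U0_ends)
      from has_integral_diff[OF int_A0 this]
      have "((\<lambda>t. symp (f0 t) (U0 t - U0 a)) has_integral A0 - symp \<Delta> p) {a..b}"
        by (simp add: symp.diff_right U0_ends)
      moreover have "0 \<le> M" using w norm_ge_zero order_trans by blast
      hence "0 \<le> (2 * M * (4 * e) + (4 * e)\<^sup>2) * L" using e0 L by simp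
      ultimately have "norm (A0 - symp \<Delta> p) \<le> (2 * M * (4 * e) + (4 * e)\<^sup>2) * L * measure lborel {a..b}"
        using symp_velocity_increment_le[OF dU0 f0w w]
        by (intro has_integral_bound_real[where S = "{}"]) (auto simp: L_def)
      hence "\<bar>A0 - symp \<Delta> p\<bar> \<le> (8 * M * e + 16 * e\<^sup>2) * L\<^sup>2"
        using ab by (simp add: L_def power2_eq_square algebra_simps)
      hence "\<bar>T - A0\<bar> \<le> (e + 8 * M * e + 16 * e\<^sup>2) * L\<^sup>2" using T by (simp add: algebra_simps)
      thus ?thesis using L by (simp add: field_simps)
    qed
    hence "sqrt (1 / 385 * \<bar>(T - A0) / L\<^sup>2\<bar>) \<le> sqrt ((e + 8 * M * e + 16 * e\<^sup>2) / 385)"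
      by (intro real_sqrt_le_mono) simp
    moreover have "(2 * i + q) / (1 / 385) = 385 * (2 * i + q)" for i q :: real by simp
    ultimately have x': "\<bar>x\<bar> \<le> 385 * (2 * e + sqrt ((e + 8 * M * e + 16 * e\<^sup>2) / 385))"
      using x by (smt (verit))
    have r: "0 \<le> s t * (1 - s t)" by (rule parabola_bounds(1)[OF s_in[OF t]])
    have "norm (c t) \<le> (6 * (s t * (1 - s t))) * norm \<kappa> + \<bar>x\<bar> * norm (Q' \<sigma> t)"
    proof -
      have "\<bar>6 * (s t * (1 - s t))\<bar> = 6 * (s t * (1 - s t))" using r by (intro abs_of_nonneg) simp
      thus ?thesis unfolding c_def
        using norm_triangle_ineq[of "(6 * (s t * (1 - s t))) *\<^sub>R \<kappa>" "x *\<^sub>R Q' \<sigma> t"]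
        by (simp only: norm_scaleR)
    qed
    also have "\<dots> \<le> (6 * (s t * (1 - s t))) * (2 * e)
        + 385 * (2 * e + sqrt ((e + 8 * M * e + 16 * e\<^sup>2) / 385)) * (8 * (s t * (1 - s t)))"
      using r \<kappa> x' norm_Q'[OF \<sigma> t] by (intro add_mono mult_left_mono mult_mono) auto
    also have "\<dots> = correction_bound M e * (s t * (1 - s t))"
      by (simp add: correction_bound_def algebra_simps)
    finally show ?thesis .
  qed
  show ?thesis
    using cont_c target bound unfolding s_def L_def by blast
qed

section \<open>Horizontal curves and the Pansu condition\<close>

lemma small_argument:
  fixes g :: "real \<Rightarrow> real"
  assumes "isCont g 0" "g 0 = 0" "0 < \<epsilon>"
  obtains e where "0 < e" "g e < \<epsilon>"
proof -
  obtain d where d: "0 < d" "\<forall>x. dist x 0 < d \<longrightarrow> dist (g x) (g 0) < \<epsilon>"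
    using assms(1,3) unfolding continuous_at_eps_delta by meson
  hence "dist (g (d / 2)) (g 0) < \<epsilon>" by (simp add: dist_real_def)
  hence "g (d / 2) < \<epsilon>" using assms(2) by (simp add: dist_real_def)
  with d(1) show thesis by (intro that[of "d / 2"]) auto
qed

lemma norm_le_fst_snd:
  fixes p :: "'a::real_normed_vector \<times> 'b::real_normed_vector"
  shows "norm (fst p) \<le> norm p" "norm (snd p) \<le> norm p"
  using norm_fst_le[of "fst p" "snd p"] norm_snd_le[of "snd p" "fst p"] by simp_all

lemma compact_continuous_norm_bound:
  fixes f :: "'a::topological_space \<Rightarrow> 'b::real_normed_vector"
  assumes "compact K" "continuous_on K f"
  obtains B where "0 \<le> B" "\<And>x. x \<in> K \<Longrightarrow> norm (f x) \<le> B"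
proof -
  obtain B where "\<And>x. x \<in> K \<Longrightarrow> norm (f x) \<le> B"
    using compact_imp_bounded[OF compact_continuous_image[OF assms(2,1)]] by (auto simp: bounded_iff)
  thus thesis by (intro that[of "max 0 B"]) (auto simp: le_max_iff_disj)
qed

text \<open>The mean value inequality settles the horizontal part. The height of the group quotient
  has a derivative of size \<open>e\<close> times the interval length, so it is itself of size
  \<open>e\<close> times the squared length, which is the order that the dilation divides
  out.\<close>

lemma horizontal_curve_pansu_differentiable:
  fixes \<gamma> D :: "real \<Rightarrow> 'n::finite heis"
  assumes K: "compact K"
    and D: "\<And>t. (\<gamma> has_vector_derivative D t) (at t)" and cont: "continuous_on UNIV D"
    and hor: "\<And>t. snd (D t) = 2 * symp (fst (D t)) (fst (\<gamma> t))"
    and "0 < \<epsilon>"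
  shows "\<exists>\<delta>>0. \<forall>a\<in>K. \<forall>b\<in>K. 0 < b - a \<and> b - a < \<delta> \<longrightarrow>
    norm (heis_dil (inverse (b - a)) (heis_mult (heis_inv (\<gamma> a)) (\<gamma> b)) - (fst (D a), 0)) < \<epsilon>"
proof -
  obtain M where M: "0 \<le> M" "\<And>a. a \<in> K \<Longrightarrow> norm (fst (D a)) \<le> M"
    by (rule compact_continuous_norm_bound[OF K, of "\<lambda>a. fst (D a)"])
      (simp_all add: continuous_on_fst[OF continuous_on_subset[OF cont]])
  obtain e where e: "0 < e" "e + 2 * (2 * M * e + e\<^sup>2) < \<epsilon>"
    by (rule small_argument[of "\<lambda>e. e + 2 * (2 * M * e + e\<^sup>2)" \<epsilon>])
      (use \<open>0 < \<epsilon>\<close> in \<open>simp_all add: continuous_intros\<close>)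
  obtain d where d: "0 < d" "\<And>a t. a \<in> K \<Longrightarrow> \<bar>t - a\<bar> < d \<Longrightarrow> norm (D t - D a) \<le> e"
    using uniform_linearization[OF K cont e(1)] by blast
  have du: "((\<lambda>t. fst (\<gamma> t)) has_vector_derivative fst (D t)) (at t within S)" for t S
    by (rule bounded_linear.has_vector_derivative[OF bounded_linear_fst has_vector_derivative_at_within[OF D]])
  have dh: "((\<lambda>t. snd (\<gamma> t)) has_vector_derivative snd (D t)) (at t within S)" for t S
    by (rule bounded_linear.has_vector_derivative[OF bounded_linear_snd has_vector_derivative_at_within[OF D]])
  have "norm (heis_dil (inverse (b - a)) (heis_mult (heis_inv (\<gamma> a)) (\<gamma> b)) - (fst (D a), 0)) < \<epsilon>"
    if ab: "a \<in> K" "b \<in> K" "0 < b - a" "b - a < d" for a b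
  proof -
    define L where "L = b - a"
    have L: "0 < L" using ab by (simp add: L_def)
    have near: "norm (fst (D t) - fst (D a)) \<le> e" if "t \<in> {a..b}" for t
      using order_trans[OF norm_le_fst_snd(1), of "D t - D a" e] d(2)[of a t] ab that by auto
    have "norm (fst (\<gamma> b) - fst (\<gamma> a) - L *\<^sub>R fst (D a)) \<le> e * L"
      unfolding L_def by (rule vector_derivative_deviation[OF du near]) (use ab in auto)
    hence "inverse L * norm (fst (\<gamma> b) - fst (\<gamma> a) - L *\<^sub>R fst (D a)) \<le> inverse L * (e * L)"
      using L by (intro mult_left_mono) auto
    also have "inverse L * norm (fst (\<gamma> b) - fst (\<gamma> a) - L *\<^sub>R fst (D a))
        = norm (inverse L *\<^sub>R (fst (\<gamma> b) - fst (\<gamma> a) - L *\<^sub>R fst (D a)))"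
      using L by simp
    also have "inverse L *\<^sub>R (fst (\<gamma> b) - fst (\<gamma> a) - L *\<^sub>R fst (D a))
        = inverse L *\<^sub>R (fst (\<gamma> b) - fst (\<gamma> a)) - fst (D a)"
      using L by (simp add: scaleR_diff_right)
    also have "inverse L * (e * L) = e" using L by simp
    finally have x: "norm (inverse L *\<^sub>R (fst (\<gamma> b) - fst (\<gamma> a)) - fst (D a)) \<le> e" .
    \<comment> \<open>The height of the quotient of \<open>\<gamma> t\<close> by
      \<open>\<gamma> a\<close>, as in \<open>heis_quotient\<close>.\<close>
    let ?f = "\<lambda>t. snd (\<gamma> t) - snd (\<gamma> a) - 2 * symp (fst (\<gamma> t)) (fst (\<gamma> a))"
    let ?m = "2 * (2 * M * e + e\<^sup>2) * L"
    have "norm (?f b - ?f a - (b - a) *\<^sub>R 0) \<le> ?m * (b - a)"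
    proof (rule vector_derivative_deviation)
      show "(?f has_vector_derivative 2 * symp (fst (D t)) (fst (\<gamma> t) - fst (\<gamma> a))) (at t within {a..b})" for t
      proof -
        have "((\<lambda>t. 2 *\<^sub>R symp (fst (\<gamma> t)) (fst (\<gamma> a))) has_vector_derivative
            2 *\<^sub>R (symp (fst (D t)) (fst (\<gamma> a)) + symp (fst (\<gamma> t)) 0)) (at t within {a..b})"
          by (intro bounded_linear.has_vector_derivative[OF bounded_linear_scaleR_right]
              symp_has_vector_derivative du has_vector_derivative_const)
        from has_vector_derivative_diff[OF has_vector_derivative_diff[OF dh has_vector_derivative_const] this]
        show ?thesis by (simp add: hor symp.zero_right symp.diff_right algebra_simps)
      qed
      show "norm (2 * symp (fst (D t)) (fst (\<gamma> t) - fst (\<gamma> a)) - 0) \<le> ?m" if "t \<in> {a..b}" for t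
        using symp_velocity_increment_le[OF du near M(2)[OF ab(1)] that]
        by (simp add: L_def abs_mult algebra_simps)
    qed (use ab in auto)
    hence "\<bar>?f b\<bar> \<le> 2 * (2 * M * e + e\<^sup>2) * L\<^sup>2" by (simp add: L_def power2_eq_square mult.assoc)
    hence y: "\<bar>(inverse L)\<^sup>2 * ?f b\<bar> \<le> 2 * (2 * M * e + e\<^sup>2)"
      using L by (simp add: abs_mult power_one_over inverse_eq_divide pos_divide_le_eq)
    have "norm (heis_dil (inverse L) (heis_mult (heis_inv (\<gamma> a)) (\<gamma> b)) - (fst (D a), 0))
        = norm (inverse L *\<^sub>R (fst (\<gamma> b) - fst (\<gamma> a)) - fst (D a), (inverse L)\<^sup>2 * ?f b)"
      by (simp add: heis_quotient)
    also have "\<dots> \<le> e + 2 * (2 * M * e + e\<^sup>2)"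
      using norm_Pair_le[of "inverse L *\<^sub>R (fst (\<gamma> b) - fst (\<gamma> a)) - fst (D a)" "(inverse L)\<^sup>2 * ?f b"] x y
      by simp
    finally show ?thesis using e by (simp add: L_def)
  qed
  with d(1) show ?thesis by blast
qed

section \<open>From the Pansu condition to a horizontal extension\<close>

lemma pansu_difference_components:
  fixes p q :: "'n::finite heis"
  assumes "0 < L"
    and "norm (heis_dil (inverse L) (heis_mult (heis_inv p) q) - (w, 0)) \<le> e"
  shows "norm (fst q - fst p - L *\<^sub>R w) \<le> e * L"
    and "\<bar>snd q - snd p - 2 * symp (fst q) (fst p)\<bar> \<le> e * L\<^sup>2"
proof -
  let ?d = "heis_dil (inverse L) (heis_mult (heis_inv p) q) - (w, 0)"
  have "norm (fst q - fst p - L *\<^sub>R w) = L * norm (fst ?d)"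
  proof -
    have "fst q - fst p - L *\<^sub>R w = L *\<^sub>R fst ?d"
      using assms(1) by (simp add: heis_quotient scaleR_diff_right)
    thus ?thesis using assms(1) by simp
  qed
  also have "\<dots> \<le> L * e"
    using order_trans[OF norm_le_fst_snd(1) assms(2)] assms(1) by (intro mult_left_mono) auto
  finally show "norm (fst q - fst p - L *\<^sub>R w) \<le> e * L" by (simp add: mult.commute)
  have "\<bar>snd q - snd p - 2 * symp (fst q) (fst p)\<bar> = L\<^sup>2 * norm (snd ?d)"
    using assms(1) by (simp add: heis_quotient abs_mult power_inverse)
  also have "\<dots> \<le> L\<^sup>2 * e"
    using order_trans[OF norm_le_fst_snd(2) assms(2)] assms(1) by (intro mult_left_mono) auto
  finally show "\<bar>snd q - snd p - 2 * symp (fst q) (fst p)\<bar> \<le> e * L\<^sup>2" by (simp add: mult.commute)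
qed

text \<open>Once \<open>V\<close> and \<open>U\<close> are fixed, the velocity of the height leaves
  no freedom. Its increments over the gaps come out right because the areas are built into
  \<open>V\<close> beforehand.\<close>

lemma horizontal_C1_extension:
  fixes F w :: "real \<Rightarrow> (real \<times> real) ^ 'n::finite" and h :: "real \<Rightarrow> real"
  assumes K: "compact K"
    and F: "continuous_on K F" and w: "continuous_on K w" and h: "continuous_on K h"
    and pansu: "\<And>e. 0 < e \<Longrightarrow> \<exists>d>0. \<forall>a\<in>K. \<forall>b\<in>K. 0 < b - a \<and> b - a < d \<longrightarrow>
      norm (F b - F a - (b - a) *\<^sub>R w a) \<le> e * (b - a) \<and>
      \<bar>h b - h a - 2 * symp (F b) (F a)\<bar> \<le> e * (b - a)\<^sup>2"
  obtains U V H where "continuous_on UNIV V"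
    "\<And>t. (U has_vector_derivative V t) (at t)"
    "\<And>t. (H has_vector_derivative 2 * symp (V t) (U t)) (at t)"
    "\<And>t. t \<in> K \<Longrightarrow> U t = F t \<and> V t = w t \<and> H t = h t"
proof -
  obtain M where M: "0 \<le> M" "\<And>t. t \<in> K \<Longrightarrow> norm (w t) \<le> M"
    using compact_continuous_norm_bound[OF K w] by blast
  obtain N1 where N1: "0 \<le> N1" "\<And>t. t \<in> K \<Longrightarrow> norm (F t) \<le> N1"
    using compact_continuous_norm_bound[OF K F] by blast
  obtain N2 where N2: "0 \<le> N2" "\<And>t. t \<in> K \<Longrightarrow> norm (h t) \<le> N2"
    using compact_continuous_norm_bound[OF K h] by blast
  \<comment> \<open>Tietze's theorem preserves the bound \<open>M\<close>, which controls the
    deviation of \<open>v\<close> on long gaps.\<close>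
  obtain v where v: "continuous_on UNIV v" "\<And>t. t \<in> K \<Longrightarrow> v t = w t" "\<And>t. norm (v t) \<le> M"
    using Tietze[OF w _ M, of UNIV] K by (auto simp: compact_imp_closed)
  \<comment> \<open>The hypotheses of the norm bound in \<open>gap_correction\<close>, with
    comparison velocity \<open>w a\<close>. The area is half the height increment because the height
    has velocity \<open>2 * symp (V t) (U t)\<close>.\<close>
  define defect where "defect a b e \<longleftrightarrow> (\<forall>t\<in>{a..b}. norm (v t - w a) \<le> e) \<and> norm (w a) \<le> M \<and>
        norm (F b - F a - (b - a) *\<^sub>R w a) \<le> e * (b - a) \<and>
        \<bar>(h b - h a) / 2 - symp (F b - F a) (F a)\<bar> \<le> e * (b - a)\<^sup>2" for a b e
  define good where "good a b c \<longleftrightarrow> continuous_on UNIV c \<and>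
    (\<forall>U. (\<forall>t\<in>{a..b}. (U has_vector_derivative v t + c t) (at t within {a..b})) \<and> U a = F a
      \<longrightarrow> U b = F a + (F b - F a) \<and> integral {a..b} (\<lambda>t. symp (v t + c t) (U t)) = (h b - h a) / 2) \<and>
    (\<forall>e. defect a b e
      \<longrightarrow> (\<forall>t\<in>{a..b}. norm (c t)
          \<le> correction_bound M e * ((t - a) / (b - a) * (1 - (t - a) / (b - a)))))" for a b c
  \<comment> \<open>One correction is fixed per gap, so that the crude and the small estimate
    concern the same function.\<close>
  define C where "C a b = (SOME c. good a b c)" for a b
  have C: "good a b (C a b)" if "gap K a b" for a b
  proof -
    have "\<exists>c. good a b c"
      using gap_correction[OF v(1), of a b "F a" "F b - F a" "(h b - h a) / 2"] that
      unfolding good_def defect_def gap_def by blast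
    thus ?thesis unfolding C_def by (rule someI_ex)
  qed
  have defect_small: "\<exists>d>0. \<forall>a b. gap K a b \<and> b - a < d \<longrightarrow> defect a b e" if e: "0 < e" for e
  proof -
    obtain d1 where d1: "0 < d1" "\<And>a t. a \<in> K \<Longrightarrow> \<bar>t - a\<bar> < d1 \<Longrightarrow> norm (v t - v a) \<le> e"
      using uniform_linearization[OF K v(1) e] by blast
    obtain d2 where d2: "0 < d2" "\<forall>a\<in>K. \<forall>b\<in>K. 0 < b - a \<and> b - a < d2 \<longrightarrow>
        norm (F b - F a - (b - a) *\<^sub>R w a) \<le> e * (b - a) \<and>
        \<bar>h b - h a - 2 * symp (F b) (F a)\<bar> \<le> e * (b - a)\<^sup>2"
      using pansu[OF e] by blast
    have "defect a b e" if ab: "gap K a b" "b - a < min d1 d2" for a b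
    proof -
      have K: "a \<in> K" "b \<in> K" "a < b" using ab by (auto simp: gap_def)
      have "norm (v t - w a) \<le> e" if "t \<in> {a..b}" for t
        using d1(2)[of a t] ab that K v(2)[of a] by auto
      moreover have "norm (F b - F a - (b - a) *\<^sub>R w a) \<le> e * (b - a)"
        and V: "\<bar>h b - h a - 2 * symp (F b) (F a)\<bar> \<le> e * (b - a)\<^sup>2"
        using d2(2) K ab by auto
      moreover have "\<bar>(h b - h a) / 2 - symp (F b - F a) (F a)\<bar> \<le> e * (b - a)\<^sup>2"
      proof -
        have "(h b - h a) / 2 - symp (F b - F a) (F a) = (h b - h a - 2 * symp (F b) (F a)) / 2"
          by (simp add: symp.diff_left field_simps)
        moreover have "\<bar>x / 2\<bar> \<le> \<bar>x\<bar>" for x :: real by simp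
        ultimately show ?thesis using V order_trans by metis
      qed
      ultimately show ?thesis using M(2) K by (auto simp: defect_def)
    qed
    thus ?thesis using d1(1) d2(1) by (intro exI[of _ "min d1 d2"]) auto
  qed
  obtain d0 where d0: "0 < d0" "\<And>a b. gap K a b \<Longrightarrow> b - a < d0 \<Longrightarrow> defect a b 1"
    using defect_small[of 1] by auto
  \<comment> \<open>The summands cover the short gaps and then, on gaps of length at least
    \<open>d0\<close>, the velocity deviation, the displacement error over the length, and the area
    error over the squared length.\<close>
  define e0 where "e0 = 1 + 2 * M + (2 * N1 / d0 + M) + (N2 + 2 * N1 * N1) / d0\<^sup>2"
  have pos: "0 \<le> 2 * N1 / d0" "0 \<le> (N2 + 2 * N1 * N1) / d0\<^sup>2"
    using M(1) N1(1) N2(1) d0(1) by auto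
  have e0: "defect a b e0" if ab: "gap K a b" for a b
  proof (cases "b - a < d0")
    case True
    have "1 \<le> e0" using pos M(1) by (simp add: e0_def)
    moreover have "1 * (b - a) \<le> e0 * (b - a)" "1 * (b - a)\<^sup>2 \<le> e0 * (b - a)\<^sup>2"
      using \<open>1 \<le> e0\<close> ab by (auto intro!: mult_right_mono simp: gap_def simp del: mult_1)
    ultimately show ?thesis
      using d0(2)[OF ab True] unfolding defect_def
      by (intro conjI ballI) (auto simp del: mult_1 dest!: bspec elim: order_trans)
  next
    case False
    have K: "a \<in> K" "b \<in> K" using ab by (auto simp: gap_def)
    define L where "L = b - a"
    have L: "d0 \<le> L" "0 < L" using False d0 by (auto simp: L_def)
    have "norm (v t - w a) \<le> e0" for t
      using norm_triangle_ineq4[of "v t" "w a"] v(3)[of t] M(1) M(2)[OF K(1)] pos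
      unfolding e0_def by linarith
    moreover have FF: "norm (F b - F a) \<le> 2 * N1"
      using norm_triangle_ineq4[of "F b" "F a"] N1(2)[OF K(1)] N1(2)[OF K(2)] by linarith
    moreover have "norm (F b - F a - L *\<^sub>R w a) \<le> e0 * L"
    proof -
      have "norm (F b - F a - L *\<^sub>R w a) \<le> 2 * N1 + L * M"
      proof -
        have "norm (L *\<^sub>R w a) \<le> L * M" using M(2)[OF K(1)] L by simp
        thus ?thesis using norm_triangle_ineq4[of "F b - F a" "L *\<^sub>R w a"] FF by linarith
      qed
      also have "2 * N1 \<le> (2 * N1 / d0) * L"
        using mult_left_mono[OF L(1) pos(1)] d0(1) by simp
      hence "2 * N1 + L * M \<le> (2 * N1 / d0 + M) * L" by (simp add: algebra_simps)
      also have "\<dots> \<le> e0 * L" using L pos M(1) by (intro mult_right_mono) (auto simp: e0_def)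
      finally show ?thesis .
    qed
    moreover have "\<bar>(h b - h a) / 2 - symp (F b - F a) (F a)\<bar> \<le> e0 * L\<^sup>2"
    proof -
      have S: "\<bar>symp (F b - F a) (F a)\<bar> \<le> 2 * N1 * N1"
        by (rule order_trans[OF abs_symp_le mult_mono]) (use FF N1 K in auto)
      have N: "\<bar>h b\<bar> \<le> N2" "\<bar>h a\<bar> \<le> N2" using N2(2) K by auto
      have "\<bar>(h b - h a) / 2 - symp (F b - F a) (F a)\<bar> \<le> N2 + 2 * N1 * N1"
        using abs_le_D1[OF S] abs_le_D2[OF S] abs_le_D1[OF N(1)] abs_le_D2[OF N(1)]
          abs_le_D1[OF N(2)] abs_le_D2[OF N(2)]
        by (intro abs_leI) (simp_all add: field_simps)
      also have "\<dots> \<le> (N2 + 2 * N1 * N1) / d0\<^sup>2 * L\<^sup>2"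
        using mult_left_mono[OF power_mono[OF L(1), of 2] pos(2)] d0(1) by simp
      also have "\<dots> \<le> e0 * L\<^sup>2" using pos M(1) by (intro mult_right_mono) (auto simp: e0_def)
      finally show ?thesis .
    qed
    ultimately show ?thesis using M(2) K by (simp add: defect_def L_def)
  qed
  obtain c where c: "continuous_on UNIV c" "\<And>t. t \<in> K \<Longrightarrow> c t = 0"
    "\<And>a b t. gap K a b \<Longrightarrow> t \<in> {a..b} \<Longrightarrow> c t = C a b t"
  proof (rule gap_functions_glue[OF compact_imp_closed[OF K], where C = C and B = "correction_bound M e0"])
    show "continuous_on UNIV (C a b)" if "gap K a b" for a b
      using C[OF that] by (simp add: good_def)
    show "norm (C a b t) \<le> correction_bound M e0 * ((t - a) / (b - a) * (1 - (t - a) / (b - a)))"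
      if "gap K a b" "t \<in> {a..b}" for a b t
      using C[OF that(1)] e0[OF that(1)] that(2) by (simp add: good_def)
    fix \<eta> :: real assume \<eta>: "0 < \<eta>"
    obtain e where e: "0 < e" "correction_bound M e < \<eta>"
      by (rule small_argument[of "correction_bound M" \<eta>])
        (use \<eta> in \<open>simp_all add: correction_bound_def[abs_def] continuous_intros\<close>)
    obtain d where d: "0 < d" "\<forall>a b. gap K a b \<and> b - a < d \<longrightarrow> defect a b e"
      using defect_small[OF e(1)] by blast
    have "norm (C a b t) \<le> \<eta>" if ab: "gap K a b" "b - a < d" and t: "t \<in> {a..b}" for a b t
    proof -
      define x where "x = (t - a) / (b - a)"
      have x: "x \<in> {0..1}" using ab t by (auto simp: x_def gap_def field_simps)
      have "norm (C a b t) \<le> correction_bound M e * (x * (1 - x))"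
        unfolding x_def using C[OF ab(1)] d(2) ab t by (simp add: good_def)
      also have "\<dots> \<le> \<eta> * (x * (1 - x))"
        using e(2) parabola_bounds(1)[OF x] by (intro mult_right_mono) auto
      also have "\<dots> \<le> \<eta> * 1"
        using \<eta> parabola_bounds(2)[OF x] by (intro mult_left_mono) auto
      finally show ?thesis by simp
    qed
    thus "\<exists>d>0. \<forall>a b. gap K a b \<and> b - a < d \<longrightarrow> (\<forall>t\<in>{a..b}. norm (C a b t) \<le> \<eta>)"
      using d(1) by blast
  qed blast
  define V where "V t = v t + c t" for t
  have V: "continuous_on UNIV V" unfolding V_def[abs_def] by (intro continuous_intros v(1) c(1))
  have VK: "V t = w t" if "t \<in> K" for t using that by (simp add: V_def v(2) c(2))
  have V_gap: "V t = v t + C a b t" if "gap K a b" "t \<in> {a..b}" for a b t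
    using c(3)[OF that] by (simp add: V_def)
  have on_gap: "U b = F b \<and> integral {a..b} (\<lambda>t. symp (V t) (U t)) = (h b - h a) / 2"
    if ab: "gap K a b" and U: "\<And>t. (U has_vector_derivative V t) (at t)" "U a = F a" for a b U
  proof -
    have "(U has_vector_derivative v t + C a b t) (at t within {a..b})" if "t \<in> {a..b}" for t
      using has_vector_derivative_at_within[OF U(1)[of t]] V_gap[OF ab that] by simp
    hence "U b = F a + (F b - F a) \<and> integral {a..b} (\<lambda>t. symp (v t + C a b t) (U t)) = (h b - h a) / 2"
      using C[OF ab] U(2) unfolding good_def by blast
    moreover have "integral {a..b} (\<lambda>t. symp (V t) (U t)) = integral {a..b} (\<lambda>t. symp (v t + C a b t) (U t))"
      by (rule integral_cong) (simp only: V_gap[OF ab])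
    ultimately show ?thesis by simp
  qed
  obtain U where U: "\<And>t. (U has_vector_derivative V t) (at t)" "\<And>t. t \<in> K \<Longrightarrow> U t = F t"
  proof (rule C1_extension_from_gaps[OF K V, of F])
    show "\<exists>d>0. \<forall>a\<in>K. \<forall>b\<in>K. 0 < b - a \<and> b - a < d
        \<longrightarrow> norm (F b - F a - (b - a) *\<^sub>R V a) \<le> e * (b - a)" if e: "0 < e" for e
    proof -
      obtain d where "0 < d" "\<forall>a\<in>K. \<forall>b\<in>K. 0 < b - a \<and> b - a < d \<longrightarrow>
          norm (F b - F a - (b - a) *\<^sub>R w a) \<le> e * (b - a) \<and>
          \<bar>h b - h a - 2 * symp (F b) (F a)\<bar> \<le> e * (b - a)\<^sup>2"
        using pansu[OF e] by blast
      thus ?thesis by (intro exI[of _ d]) (simp add: VK)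
    qed
    show "U b - U a = F b - F a" if "gap K a b" "\<And>t. (U has_vector_derivative V t) (at t)" for a b U
    proof -
      \<comment> \<open>The gap property speaks of curves starting at \<open>F a\<close>, so an
        arbitrary antiderivative is first shifted there.\<close>
      have "((\<lambda>t. U t + (F a - U a)) has_vector_derivative V t + 0) (at t)" for t
        by (intro has_vector_derivative_add has_vector_derivative_const that(2))
      hence "U b + (F a - U a) = F b"
        using on_gap[OF that(1), of "\<lambda>t. U t + (F a - U a)"] by simp
      thus ?thesis by (simp add: algebra_simps)
    qed
  qed blast
  have cont_U: "continuous_on UNIV U"
    using U(1) by (auto simp: continuous_on_eq_continuous_at intro: has_vector_derivative_continuous)
  define A where "A t = 2 * symp (V t) (U t)" for t
  have A: "continuous_on UNIV A"
    unfolding A_def[abs_def] by (intro continuous_intros symp.continuous_on V cont_U)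
  obtain H where H: "\<And>t. (H has_vector_derivative A t) (at t)" "\<And>t. t \<in> K \<Longrightarrow> H t = h t"
  proof (rule C1_extension_from_gaps[OF K A, of h])
    fix e :: real assume e: "0 < e"
    \<comment> \<open>Leaves room for the factor \<open>N1\<close> that arises when the horizontal
      error is paired with \<open>F a\<close>.\<close>
    define e1 where "e1 = e / (1 + 2 * N1)"
    have e1: "0 < e1" "e1 * (1 + 2 * N1) = e" using e N1(1) by (auto simp: e1_def)
    obtain d where d: "0 < d" "\<forall>a\<in>K. \<forall>b\<in>K. 0 < b - a \<and> b - a < d \<longrightarrow>
        norm (F b - F a - (b - a) *\<^sub>R w a) \<le> e1 * (b - a) \<and>
        \<bar>h b - h a - 2 * symp (F b) (F a)\<bar> \<le> e1 * (b - a)\<^sup>2"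
      using pansu[OF e1(1)] by blast
    have "norm (h b - h a - (b - a) *\<^sub>R A a) \<le> e * (b - a)"
      if ab: "a \<in> K" "b \<in> K" "0 < b - a" "b - a < min d 1" for a b
    proof -
      define L where "L = b - a"
      have L: "0 < L" "L \<le> 1" using ab by (auto simp: L_def)
      have d': "norm (F b - F a - L *\<^sub>R w a) \<le> e1 * L"
        "\<bar>h b - h a - 2 * symp (F b) (F a)\<bar> \<le> e1 * L\<^sup>2"
        using d(2) ab by (auto simp: L_def)
      have "\<bar>symp (F b - F a - L *\<^sub>R w a) (F a)\<bar> \<le> (e1 * L) * N1"
        by (rule order_trans[OF abs_symp_le mult_mono]) (use d' N1 ab e1 L in auto)
      moreover have "e1 * L\<^sup>2 \<le> e1 * L"
        using L e1 by (simp add: power2_eq_square mult_left_le)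
      \<comment> \<open>As \<open>symp (F a) (F a) = 0\<close>, the first-order error of
        \<open>h\<close> is the vertical Pansu error plus twice the horizontal error paired with
        \<open>F a\<close>.\<close>
      moreover have "h b - h a - L * A a = (h b - h a - 2 * symp (F b) (F a))
          + 2 * symp (F b - F a - L *\<^sub>R w a) (F a)"
        using VK[OF ab(1)] U(2)[OF ab(1)] by (simp add: A_def symp.diff_left symp.scaleR_left)
      ultimately have "\<bar>h b - h a - L * A a\<bar> \<le> e1 * L + 2 * ((e1 * L) * N1)"
        using d'(2) by linarith
      also have "\<dots> = (e1 * (1 + 2 * N1)) * L" by (simp add: algebra_simps)
      finally show ?thesis by (simp add: L_def e1(2))
    qed
    thus "\<exists>d>0. \<forall>a\<in>K. \<forall>b\<in>K. 0 < b - a \<and> b - a < d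
        \<longrightarrow> norm (h b - h a - (b - a) *\<^sub>R A a) \<le> e * (b - a)"
      using d(1) by (intro exI[of _ "min d 1"]) auto
  next
    fix a b and H :: "real \<Rightarrow> real"
    assume ab: "gap K a b" and dH: "\<And>t. (H has_vector_derivative A t) (at t)"
    have "(A has_integral (H b - H a)) {a..b}"
      by (rule fundamental_theorem_of_calculus[OF _ has_vector_derivative_at_within[OF dH]])
        (use ab in \<open>simp add: gap_def\<close>)
    hence "H b - H a = integral {a..b} A" by (simp add: integral_unique)
    also have "\<dots> = 2 * integral {a..b} (\<lambda>t. symp (V t) (U t))"
      unfolding A_def[abs_def] by (rule integral_mult_right)
    also have "\<dots> = h b - h a"
      using on_gap[OF ab U(1)] U(2)[of a] ab by (simp add: gap_def)
    finally show "H b - H a = h b - h a" .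
  qed blast
  show thesis
    by (rule that[OF V U(1) H(1)[unfolded A_def]]) (simp add: U(2) VK H(2))
qed

section \<open>Extendability is equivalent to the Pansu and contact conditions\<close>

theorem theorem1p7:
  fixes K :: "real set"
    and \<Gamma> \<Gamma>' :: "real \<Rightarrow> 'n::finite heis"
  assumes "compact K"
    and "continuous_on K \<Gamma>"
    and "continuous_on K \<Gamma>'"
  shows "(\<exists>\<gamma>. horizontal_C1_curve \<gamma> \<and>
            (\<forall>s\<in>K. \<gamma> s = \<Gamma> s) \<and>
            (\<forall>s\<in>K. vector_derivative \<gamma> (at s) = \<Gamma>' s))
     \<longleftrightarrow>
         (\<forall>\<epsilon>>0. \<exists>\<delta>>0. \<forall>a\<in>K. \<forall>b\<in>K. 0 < b - a \<and> b - a < \<delta> \<longrightarrow>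
            norm (heis_dil (inverse (b - a)) (heis_mult (heis_inv (\<Gamma> a)) (\<Gamma> b))
                  - (fst (\<Gamma>' a), 0)) < \<epsilon>)
       \<and> (\<forall>s\<in>K. tc (\<Gamma>' s) =
            2 * (\<Sum>j\<in>UNIV. xc (\<Gamma>' s) j * yc (\<Gamma> s) j - yc (\<Gamma>' s) j * xc (\<Gamma> s) j))"
    (is "?extension \<longleftrightarrow> ?pansu \<and> ?contact")
proof
  assume ?extension
  then obtain \<gamma> D where \<gamma>: "\<And>s. s \<in> K \<Longrightarrow> \<gamma> s = \<Gamma> s" "\<And>s. s \<in> K \<Longrightarrow> vector_derivative \<gamma> (at s) = \<Gamma>' s"
    and D: "\<And>s. (\<gamma> has_vector_derivative D s) (at s)" "continuous_on UNIV D"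
    and hor: "\<And>s. vector_derivative \<gamma> (at s) \<in> horizontal_space (\<gamma> s)"
    unfolding horizontal_C1_curve_def C1_differentiable_on_def by blast
  have vd: "vector_derivative \<gamma> (at s) = D s" for s by (rule vector_derivative_at[OF D(1)])
  have hor': "snd (D s) = 2 * symp (fst (D s)) (fst (\<gamma> s))" for s
    using hor[of s] by (simp add: vd horizontal_space_iff)
  have DK: "D s = \<Gamma>' s" if "s \<in> K" for s using \<gamma>(2)[OF that] by (simp add: vd)
  have "snd (\<Gamma>' s) = 2 * symp (fst (\<Gamma>' s)) (fst (\<Gamma> s))" if "s \<in> K" for s
    using hor'[of s] that by (simp add: DK \<gamma>(1))
  hence ?contact by (simp add: symp_def)
  moreover have ?pansu
  proof (intro allI impI)
    fix \<epsilon> :: real assume "0 < \<epsilon>"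
    then obtain \<delta> where "0 < \<delta>" "\<forall>a\<in>K. \<forall>b\<in>K. 0 < b - a \<and> b - a < \<delta> \<longrightarrow>
        norm (heis_dil (inverse (b - a)) (heis_mult (heis_inv (\<gamma> a)) (\<gamma> b)) - (fst (D a), 0)) < \<epsilon>"
      using horizontal_curve_pansu_differentiable[OF assms(1) D hor', of \<epsilon>] by blast
    thus "\<exists>\<delta>>0. \<forall>a\<in>K. \<forall>b\<in>K. 0 < b - a \<and> b - a < \<delta> \<longrightarrow>
        norm (heis_dil (inverse (b - a)) (heis_mult (heis_inv (\<Gamma> a)) (\<Gamma> b)) - (fst (\<Gamma>' a), 0)) < \<epsilon>"
      by (intro exI[of _ \<delta>]) (simp add: \<gamma>(1) DK)
  qed
  ultimately show "?pansu \<and> ?contact" by blast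
next
  assume R: "?pansu \<and> ?contact"
  have pansu: "\<exists>d>0. \<forall>a\<in>K. \<forall>b\<in>K. 0 < b - a \<and> b - a < d \<longrightarrow>
      norm (fst (\<Gamma> b) - fst (\<Gamma> a) - (b - a) *\<^sub>R fst (\<Gamma>' a)) \<le> e * (b - a) \<and>
      \<bar>snd (\<Gamma> b) - snd (\<Gamma> a) - 2 * symp (fst (\<Gamma> b)) (fst (\<Gamma> a))\<bar> \<le> e * (b - a)\<^sup>2"
    if e: "0 < e" for e
  proof -
    obtain d where d: "0 < d" "\<forall>a\<in>K. \<forall>b\<in>K. 0 < b - a \<and> b - a < d \<longrightarrow>
        norm (heis_dil (inverse (b - a)) (heis_mult (heis_inv (\<Gamma> a)) (\<Gamma> b)) - (fst (\<Gamma>' a), 0)) < e"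
      using R e by blast
    hence "norm (fst (\<Gamma> b) - fst (\<Gamma> a) - (b - a) *\<^sub>R fst (\<Gamma>' a)) \<le> e * (b - a) \<and>
        \<bar>snd (\<Gamma> b) - snd (\<Gamma> a) - 2 * symp (fst (\<Gamma> b)) (fst (\<Gamma> a))\<bar> \<le> e * (b - a)\<^sup>2"
      if "a \<in> K" "b \<in> K" "0 < b - a \<and> b - a < d" for a b
      using that by (intro conjI pansu_difference_components less_imp_le) auto
    with d(1) show ?thesis by blast
  qed
  obtain U V H where V: "continuous_on UNIV V"
    and U: "\<And>t. (U has_vector_derivative V t) (at t)"
    and H: "\<And>t. (H has_vector_derivative 2 * symp (V t) (U t)) (at t)"
    and K: "\<And>t. t \<in> K \<Longrightarrow> U t = fst (\<Gamma> t) \<and> V t = fst (\<Gamma>' t) \<and> H t = snd (\<Gamma> t)"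
    by (rule horizontal_C1_extension[OF assms(1) continuous_on_fst[OF assms(2)]
          continuous_on_fst[OF assms(3)] continuous_on_snd[OF assms(2)] pansu]) blast+
  define \<gamma> where "\<gamma> t = (U t, H t)" for t
  define D where "D t = (V t, 2 * symp (V t) (U t))" for t
  have D: "(\<gamma> has_vector_derivative D t) (at t)" for t
    unfolding \<gamma>_def[abs_def] D_def by (rule has_vector_derivative_Pair[OF U H])
  have "continuous_on UNIV U"
    using U by (auto simp: continuous_on_eq_continuous_at intro: has_vector_derivative_continuous)
  hence "continuous_on UNIV D"
    unfolding D_def[abs_def] by (intro continuous_intros symp.continuous_on V)
  hence "horizontal_C1_curve \<gamma>"
    using D unfolding horizontal_C1_curve_def C1_differentiable_on_def
    by (intro conjI exI[of _ D] allI)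
      (simp_all add: vector_derivative_at[OF D] horizontal_space_iff, simp add: D_def \<gamma>_def)
  moreover have "\<gamma> s = \<Gamma> s" if "s \<in> K" for s using K[OF that] by (simp add: \<gamma>_def)
  moreover have "vector_derivative \<gamma> (at s) = \<Gamma>' s" if "s \<in> K" for s
  proof -
    \<comment> \<open>The contact condition identifies the height velocity of the extension with the
      prescribed one.\<close>
    have "snd (\<Gamma>' s) = 2 * symp (fst (\<Gamma>' s)) (fst (\<Gamma> s))"
      using R that by (simp add: symp_def)
    with K[OF that] show ?thesis by (simp add: vector_derivative_at[OF D] D_def prod_eq_iff)
  qed
  ultimately show ?extension by blast
qed

end
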